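(* Let \(\theta(z)=e^{zN}.F_\infty\) be an admissible nilpotent orbit in \(\mathcal M\), let \(F_o\in\mathcal M\) be such that \((F_o,W)\) is split over \(\mathbb R\), and set \(Y_o=Y_{(F_o,W)}\). Let \(h:(a,\infty)\to H\) be a differentiable function such that for all \(y\): (a) \(Gr(h(y))\) maps the filtration induced by \(F_o\) on \(Gr^W\) to the filtration induced by \(\theta(iy)\) on \(Gr^W\), and \(\mathrm{Ad}(h(y))Y_o=Y_{(\theta(iy),W)}\); (b) \(h^{-1}(y)\frac{dh}{dy}\in\mathfrak h\cap(\eta_+\oplus\Lambda\oplus\eta_-)\). Then \[h^{-1}(y)\frac{d}{dy}h(y)=-L\,\mathrm{Ad}(h^{-1}(y))N.\]
   Context: \(V_{\mathbb Q}\) finite-dimensional over \(\mathbb Q\), \(V=V_{\mathbb Q}\otimes\mathbb C\), \(W\) an increasing rational filtration, \(Q=\{Q_k\}\) nondegenerate rational bilinear forms on \(Gr^W_k\) of parity \((-1)^k\). \(\mathcal M\) is the set of decreasing filtrations \(F\) (fixed \(\dim F^p\)) such that \((F,W)\) is a mixed Hodge structure graded-polarized by \(Q\). \(G=\{g\in GL(V):g\text{ preserves }W,\ Gr(g)\text{ real automorphism of }Q\}\), \(G_{\mathbb C}\) analogous with complex automorphisms, \(\check{\mathcal M}\) the \(G_{\mathbb C}\)-orbit of \(\mathcal M\), \(\mathfrak g_{\mathbb C}=\mathrm{Lie}(G_{\mathbb C})\), \(\mathfrak g_{\mathbb R}\) the real elements of \(\mathrm{Lie}(G)\). \(H=\{g\in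 G: g\text{ induces real automorphisms of }W_k/W_{k-2}\ \forall k\}\), \(\mathfrak h=\mathrm{Lie}(H)\). Deligne bigrading of a mixed Hodge structure \((F,W')\): unique \(V=\bigoplus I^{p,q}\) with \(F^p=\bigoplus_{a\ge p}I^{a,b}\), \(W'_k=\bigoplus_{a+b\le k}I^{a,b}\), \(\overline{I^{p,q}}\equiv I^{q,p}\bmod\bigoplus_{r<q,s<p}I^{r,s}\); split over \(\mathbb R\) if equality; \(Y_{(F,W')}\) acts as \(p+q\) on \(I^{p,q}\). With respect to \((F_o,W)\), \(\mathfrak g^{r,s}_{\mathbb C}\) = elements of \(\mathfrak g_{\mathbb C}\) mapping \(I^{p,q}\) to \(I^{p+r,q+s}\), and \(\mathfrak g_{\mathbb C}=\eta_+\oplus\eta_0\oplus\eta_-\oplus\Lambda\) with \(\eta_+=\bigoplus_{r\ge0,s<0}\mathfrak g^{r,s}_{\mathbb C}\), \(\eta_0=\mathfrak g^{0,0}_{\mathbb C}\), \(\eta_-=\bigoplus_{r<0,s\ge0}\mathfrak g^{r,s}_{\mathbb C}\), \(\Lambda=\bigoplus_{r,s<0}\mathfrak g^{r,s}_{\mathbb C}\). \(L\) is the endomorphism acting as \(+i\) on \(\eta_+\), \(0\) on \(\eta_0\), \(-i\) on \(\eta_-\oplus\Lambda\). Admissible nilpotent orbit: \(\theta(z)=e^{zN}.F_\infty\) with \(F_\infty\in\check{\mathcal M}\), \(N\in\mathfrak g_{\mathbb R}\) nilpotent, \(N(F_\infty^p)\subset F_\infty^{p-1}\), \(\theta(z)\in\mathcal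 M\) for \(\mathrm{Im}\,z\gg0\) (in particular for \(z=iy\), \(y>a\)), and the relative weight filtration \({}^rW(N,W)\) exists. *)

theory Defs
  imports "HOL-Analysis.Analysis"
begin

text \<open>Model: V_Q = Q^n, V = C^n = complex^'n with its standard rational structure
(rational vectors = vectors with rational coordinates); complex conjugation acts
coordinatewise. Endomorphisms of V are matrices complex^'n^'n.\<close>

type_synonym 'n vecC = "complex^'n"
type_synonym 'n matC = "complex^'n^'n"

definition cvconj :: "('n::finite) vecC \<Rightarrow> ('n::finite) vecC" where
  "cvconj v = (\<chi> i. cnj (v $ i))"

definition cmconj :: "('n::finite) matC \<Rightarrow> ('n::finite) matC" where
  "cmconj A = (\<chi> i j. cnj (A $ i $ j))"

definition mscale :: "complex \<Rightarrow> ('n::finite) matC \<Rightarrow> ('n::finite) matC" where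
  "mscale c A = (\<chi> i j. c * A $ i $ j)"

definition rat_vec :: "('n::finite) vecC \<Rightarrow> bool" where
  "rat_vec v \<longleftrightarrow> (\<forall>i. v $ i \<in> \<rat>)"

definition real_mat :: "('n::finite) matC \<Rightarrow> bool" where
  "real_mat A \<longleftrightarrow> cmconj A = A"

definition csubspace :: "('n::finite) vecC set \<Rightarrow> bool" where
  "csubspace S \<longleftrightarrow> 0 \<in> S \<and> (\<forall>x\<in>S. \<forall>y\<in>S. x + y \<in> S) \<and> (\<forall>c. \<forall>x\<in>S. c *s x \<in> S)"

definition cspan :: "('n::finite) vecC set \<Rightarrow> ('n::finite) vecC set" where
  "cspan S = {x. \<exists>T c. finite T \<and> T \<subseteq> S \<and> x = (\<Sum>t\<in>T. c t *s t)}"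

definition sumset :: "('n::finite) vecC set \<Rightarrow> ('n::finite) vecC set \<Rightarrow> ('n::finite) vecC set" where
  "sumset A B = {a + b | a b. a \<in> A \<and> b \<in> B}"

definition mimg :: "('n::finite) matC \<Rightarrow> ('n::finite) vecC set \<Rightarrow> ('n::finite) vecC set" where
  "mimg g S = (\<lambda>v. g *v v) ` S"

definition bil :: "('n::finite) matC \<Rightarrow> ('n::finite) vecC \<Rightarrow> ('n::finite) vecC \<Rightarrow> complex" where
  "bil B u v = (\<Sum>i\<in>UNIV. u $ i * (B *v v) $ i)"

text \<open>Standing assumptions: W increasing rational (finite, exhaustive) filtration;
Q k a rational bilinear form on W_k vanishing on W_(k-1), hence a form on Gr^W_k,
nondegenerate there and of parity (-1)^k.\<close>
definition standing :: "(int \<Rightarrow> ('n::finite) vecC set) \<Rightarrow> (int \<Rightarrow> ('n::finite) matC) \<Rightarrow> bool" where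
  "standing W Q \<longleftrightarrow>
     (\<forall>k. csubspace (W k) \<and> W k \<subseteq> W (k + 1) \<and> W k = cspan {v \<in> W k. rat_vec v}) \<and>
     (\<exists>k0 k1. W k0 = {0} \<and> W k1 = UNIV) \<and>
     (\<forall>k. \<forall>u\<in>W k. \<forall>v\<in>W k. rat_vec u \<longrightarrow> rat_vec v \<longrightarrow> bil (Q k) u v \<in> \<rat>) \<and>
     (\<forall>k. \<forall>u\<in>W k. \<forall>v\<in>W k. bil (Q k) v u = (-1) ^ nat \<bar>k\<bar> * bil (Q k) u v) \<and>
     (\<forall>k. \<forall>u\<in>W (k - 1). \<forall>v\<in>W k. bil (Q k) u v = 0) \<and>
     (\<forall>k. \<forall>v\<in>W k. (\<forall>u\<in>W k. bil (Q k) v u = 0) \<longrightarrow> v \<in> W (k - 1))"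

text \<open>The set M (depending on the fixed dimensions dF of the F^p, measured as real
dimensions) of decreasing filtrations F such that (F,W) is a mixed Hodge structure
graded-polarized by Q.\<close>
definition Mset :: "(int \<Rightarrow> ('n::finite) vecC set) \<Rightarrow> (int \<Rightarrow> ('n::finite) matC) \<Rightarrow> (int \<Rightarrow> nat)
    \<Rightarrow> (int \<Rightarrow> ('n::finite) vecC set) set" where
  "Mset W Q dF = {F.
     (\<forall>p. csubspace (F p) \<and> F (p + 1) \<subseteq> F p \<and> dim (F p) = dF p) \<and>
     (\<exists>p0 p1. F p0 = UNIV \<and> F p1 = {0}) \<and>
     \<comment> \<open>F induces a pure Hodge structure of weight k on Gr^W_k\<close>
     (\<forall>k p. sumset (sumset (F p \<inter> W k) (W (k - 1)))
                      (cvconj ` sumset (F (k - p + 1) \<inter> W k) (W (k - 1))) = W k \<and>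
            sumset (F p \<inter> W k) (W (k - 1)) \<inter>
              cvconj ` sumset (F (k - p + 1) \<inter> W k) (W (k - 1)) = W (k - 1)) \<and>
     \<comment> \<open>polarization: first Hodge--Riemann relation\<close>
     (\<forall>k p. \<forall>u\<in>F p \<inter> W k. \<forall>v\<in>F (k - p + 1) \<inter> W k. bil (Q k) u v = 0) \<and>
     \<comment> \<open>polarization: second Hodge--Riemann relation on H^{p,q} of Gr^W_k\<close>
     (\<forall>k p q v. p + q = k \<longrightarrow>
        v \<in> sumset (F p \<inter> W k) (W (k - 1)) \<longrightarrow>
        v \<in> cvconj ` sumset (F q \<inter> W k) (W (k - 1)) \<longrightarrow>
        v \<notin> W (k - 1) \<longrightarrow>
        \<i> powi (p - q) * bil (Q k) v (cvconj v) \<in> \<real> \<and>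
        Re (\<i> powi (p - q) * bil (Q k) v (cvconj v)) > 0)}"

definition isum :: "(int \<Rightarrow> int \<Rightarrow> ('n::finite) vecC set) \<Rightarrow> (int \<Rightarrow> int \<Rightarrow> bool) \<Rightarrow> ('n::finite) vecC set" where
  "isum I P = {sum x S | S x. finite S \<and> S \<subseteq> {(a, b). P a b} \<and>
                               (\<forall>(a, b)\<in>S. x (a, b) \<in> I a b)}"

definition is_deligne_bigrading ::
    "(int \<Rightarrow> ('n::finite) vecC set) \<Rightarrow> (int \<Rightarrow> ('n::finite) vecC set) \<Rightarrow> (int \<Rightarrow> int \<Rightarrow> ('n::finite) vecC set) \<Rightarrow> bool" where
  "is_deligne_bigrading F W' I \<longleftrightarrow>
     (\<forall>p q. csubspace (I p q)) \<and>
     (\<forall>S x. finite S \<longrightarrow> (\<forall>(a, b)\<in>S. x (a, b) \<in> I a b) \<longrightarrow> sum x S = 0 \<longrightarrow>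
            (\<forall>s\<in>S. x s = 0)) \<and>
     isum I (\<lambda>a b. True) = UNIV \<and>
     (\<forall>p. F p = isum I (\<lambda>a b. a \<ge> p)) \<and>
     (\<forall>k. W' k = isum I (\<lambda>a b. a + b \<le> k)) \<and>
     (\<forall>p q. sumset (cvconj ` I p q) (isum I (\<lambda>r s. r < q \<and> s < p)) =
            sumset (I q p) (isum I (\<lambda>r s. r < q \<and> s < p)))"

definition deligne :: "(int \<Rightarrow> ('n::finite) vecC set) \<Rightarrow> (int \<Rightarrow> ('n::finite) vecC set) \<Rightarrow> int \<Rightarrow> int \<Rightarrow> ('n::finite) vecC set" where
  "deligne F W' = (THE I. is_deligne_bigrading F W' I)"

definition split_R :: "(int \<Rightarrow> ('n::finite) vecC set) \<Rightarrow> (int \<Rightarrow> ('n::finite) vecC set) \<Rightarrow> bool" where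
  "split_R F W' \<longleftrightarrow> (\<forall>p q. cvconj ` deligne F W' p q = deligne F W' q p)"

definition Yop :: "(int \<Rightarrow> ('n::finite) vecC set) \<Rightarrow> (int \<Rightarrow> ('n::finite) vecC set) \<Rightarrow> ('n::finite) matC" where
  "Yop F W' = (THE Y. \<forall>p q. \<forall>v\<in>deligne F W' p q. Y *v v = of_int (p + q) *s v)"

definition GC :: "(int \<Rightarrow> ('n::finite) vecC set) \<Rightarrow> (int \<Rightarrow> ('n::finite) matC) \<Rightarrow> ('n::finite) matC set" where
  "GC W Q = {g. invertible g \<and> (\<forall>k. mimg g (W k) \<subseteq> W k) \<and>
               (\<forall>k. \<forall>u\<in>W k. \<forall>v\<in>W k. bil (Q k) (g *v u) (g *v v) = bil (Q k) u v)}"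

definition Ggrp :: "(int \<Rightarrow> ('n::finite) vecC set) \<Rightarrow> (int \<Rightarrow> ('n::finite) matC) \<Rightarrow> ('n::finite) matC set" where
  "Ggrp W Q = {g \<in> GC W Q. \<forall>k. mimg (g - cmconj g) (W k) \<subseteq> W (k - 1)}"

definition Hgrp :: "(int \<Rightarrow> ('n::finite) vecC set) \<Rightarrow> (int \<Rightarrow> ('n::finite) matC) \<Rightarrow> ('n::finite) matC set" where
  "Hgrp W Q = {g \<in> Ggrp W Q. \<forall>k. mimg (g - cmconj g) (W k) \<subseteq> W (k - 2)}"

definition gC :: "(int \<Rightarrow> ('n::finite) vecC set) \<Rightarrow> (int \<Rightarrow> ('n::finite) matC) \<Rightarrow> ('n::finite) matC set" where
  "gC W Q = {X. (\<forall>k. mimg X (W k) \<subseteq> W k) \<and>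
               (\<forall>k. \<forall>u\<in>W k. \<forall>v\<in>W k. bil (Q k) (X *v u) v + bil (Q k) u (X *v v) = 0)}"

definition gR :: "(int \<Rightarrow> ('n::finite) vecC set) \<Rightarrow> (int \<Rightarrow> ('n::finite) matC) \<Rightarrow> ('n::finite) matC set" where
  "gR W Q = {X \<in> gC W Q. real_mat X}"

definition hlie :: "(int \<Rightarrow> ('n::finite) vecC set) \<Rightarrow> (int \<Rightarrow> ('n::finite) matC) \<Rightarrow> ('n::finite) matC set" where
  "hlie W Q = {X \<in> gC W Q. \<forall>k. mimg (X - cmconj X) (W k) \<subseteq> W (k - 2)}"

definition grs :: "(int \<Rightarrow> ('n::finite) vecC set) \<Rightarrow> (int \<Rightarrow> ('n::finite) matC) \<Rightarrow> (int \<Rightarrow> ('n::finite) vecC set)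
    \<Rightarrow> int \<Rightarrow> int \<Rightarrow> ('n::finite) matC set" where
  "grs W Q Fo r s = {X \<in> gC W Q. \<forall>p q. mimg X (deligne Fo W p q) \<subseteq> deligne Fo W (p + r) (q + s)}"

definition gsum :: "(int \<Rightarrow> ('n::finite) vecC set) \<Rightarrow> (int \<Rightarrow> ('n::finite) matC) \<Rightarrow> (int \<Rightarrow> ('n::finite) vecC set)
    \<Rightarrow> (int \<Rightarrow> int \<Rightarrow> bool) \<Rightarrow> ('n::finite) matC set" where
  "gsum W Q Fo P = {sum X S | S X. finite S \<and> S \<subseteq> {(r, s). P r s} \<and>
                                   (\<forall>(r, s)\<in>S. X (r, s) \<in> grs W Q Fo r s)}"

definition eta_plus where "eta_plus W Q Fo = gsum W Q Fo (\<lambda>r s. r \<ge> 0 \<and> s < 0)"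
definition eta_zero where "eta_zero W Q Fo = gsum W Q Fo (\<lambda>r s. r = 0 \<and> s = 0)"
definition eta_minus where "eta_minus W Q Fo = gsum W Q Fo (\<lambda>r s. r < 0 \<and> s \<ge> 0)"
definition Lambda_rs where "Lambda_rs W Q Fo = gsum W Q Fo (\<lambda>r s. r < 0 \<and> s < 0)"

definition Lop :: "(int \<Rightarrow> ('n::finite) vecC set) \<Rightarrow> (int \<Rightarrow> ('n::finite) matC) \<Rightarrow> (int \<Rightarrow> ('n::finite) vecC set)
    \<Rightarrow> ('n::finite) matC \<Rightarrow> ('n::finite) matC" where
  "Lop W Q Fo X = (THE Z. \<exists>A B C D. A \<in> eta_plus W Q Fo \<and> B \<in> eta_zero W Q Fo \<and>
        C \<in> eta_minus W Q Fo \<and> D \<in> Lambda_rs W Q Fo \<and> X = A + B + C + D \<and>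
        Z = mscale \<i> A - mscale \<i> (C + D))"

primrec mpow :: "('n::finite) matC \<Rightarrow> nat \<Rightarrow> ('n::finite) matC" where
  "mpow A 0 = mat 1"
| "mpow A (Suc k) = A ** mpow A k"

definition nilpotent_mat :: "('n::finite) matC \<Rightarrow> bool" where
  "nilpotent_mat N \<longleftrightarrow> (\<exists>k. mpow N k = 0)"

definition mexp_nil :: "complex \<Rightarrow> ('n::finite) matC \<Rightarrow> ('n::finite) matC" where
  "mexp_nil z N = (\<Sum>k<CARD('n). mscale (z ^ k / of_nat (fact k)) (mpow N k))"

definition theta :: "('n::finite) matC \<Rightarrow> (int \<Rightarrow> ('n::finite) vecC set) \<Rightarrow> complex \<Rightarrow> int \<Rightarrow> ('n::finite) vecC set" where
  "theta N Finf z p = mimg (mexp_nil z N) (Finf p)"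

definition Mcheck :: "(int \<Rightarrow> ('n::finite) vecC set) \<Rightarrow> (int \<Rightarrow> ('n::finite) matC) \<Rightarrow> (int \<Rightarrow> nat)
    \<Rightarrow> (int \<Rightarrow> ('n::finite) vecC set) set" where
  "Mcheck W Q dF = {(\<lambda>p. mimg g (F p)) | g F. g \<in> GC W Q \<and> F \<in> Mset W Q dF}"

text \<open>Relative weight filtration M = rW(N,W): increasing finite filtration with
N M_k \<subseteq> M_(k-2) and N^j : Gr^M_(l+j) Gr^W_l \<cong> Gr^M_(l-j) Gr^W_l for j \<ge> 0.\<close>
definition is_rel_weight_filtration ::
    "('n::finite) matC \<Rightarrow> (int \<Rightarrow> ('n::finite) vecC set) \<Rightarrow> (int \<Rightarrow> ('n::finite) vecC set) \<Rightarrow> bool" where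
  "is_rel_weight_filtration N W M \<longleftrightarrow>
     (\<forall>k. csubspace (M k) \<and> M k \<subseteq> M (k + 1)) \<and>
     (\<exists>k0 k1. M k0 = {0} \<and> M k1 = UNIV) \<and>
     (\<forall>k. mimg N (M k) \<subseteq> M (k - 2)) \<and>
     (\<forall>l j. let A = sumset (M (l + int j) \<inter> W l) (W (l - 1));
                A' = sumset (M (l + int j - 1) \<inter> W l) (W (l - 1));
                B = sumset (M (l - int j) \<inter> W l) (W (l - 1));
                B' = sumset (M (l - int j - 1) \<inter> W l) (W (l - 1))
            in (\<forall>x\<in>A. mpow N j *v x \<in> B' \<longrightarrow> x \<in> A') \<and>
               B \<subseteq> sumset (mimg (mpow N j) A) B')"

definition admissible_nilpotent_orbit ::
    "(int \<Rightarrow> ('n::finite) vecC set) \<Rightarrow> (int \<Rightarrow> ('n::finite) matC) \<Rightarrow> (int \<Rightarrow> nat) \<Rightarrow> ('n::finite) matC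
     \<Rightarrow> (int \<Rightarrow> ('n::finite) vecC set) \<Rightarrow> real \<Rightarrow> bool" where
  "admissible_nilpotent_orbit W Q dF N Finf a \<longleftrightarrow>
     Finf \<in> Mcheck W Q dF \<and> N \<in> gR W Q \<and> nilpotent_mat N \<and>
     (\<forall>p. mimg N (Finf p) \<subseteq> Finf (p - 1)) \<and>
     (\<exists>b. \<forall>z. Im z > b \<longrightarrow> theta N Finf z \<in> Mset W Q dF) \<and>
     (\<forall>y>a. theta N Finf (\<i> * of_real y) \<in> Mset W Q dF) \<and>
     (\<exists>M. is_rel_weight_filtration N W M)"

end

theory Submission
  imports Defs
begin

text \<open>
  Write \<open>A = h\<^sup>-\<^sup>1 h'\<close>, \<open>M = Ad(h\<^sup>-\<^sup>1) N\<close> and \<open>k = h\<^sup>-\<^sup>1 \<cdot> conj h\<close>. Hypothesis (a) forces \<open>h\<close> to carry the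
  Deligne bigrading of \<open>F\<^sub>o\<close> onto that of \<open>\<theta>(iy)\<close>. Two consequences follow.

  First, \<open>e\<^sup>-\<^sup>i\<^sup>y\<^sup>N h\<close> maps \<open>F\<^sub>o\<close> onto the constant filtration \<open>F\<^sub>\<infinity>\<close>, so \<open>B = A - iM\<close> preserves \<open>F\<^sub>o\<close>: it lies
  in \<open>\<eta>\<^sub>+ + \<eta>\<^sub>0\<close>, which determines the components of \<open>A\<close> in \<open>\<eta>\<^sub>- + \<Lambda>\<close>.

  Second, comparing the conjugation property of the two bigradings gives \<open>k \<in> 1 + \<Lambda>\<close> and
  \<open>k \<cdot> conj k = 1\<close>. Differentiating \<open>h k = conj h\<close> gives \<open>A = Ad(k) (conj A)\<close> modulo \<open>\<Lambda>\<close>, and \<open>M = Ad(k) (conj M)\<close>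
  because \<open>N\<close> is real. As \<open>Ad(k) (conj B)\<close> has no component in \<open>\<eta>\<^sub>+\<close>, the \<open>\<eta>\<^sub>+\<close>-component of \<open>A\<close> is \<open>-i\<close> times
  that of \<open>M\<close>. Since (b) excludes an \<open>\<eta>\<^sub>0\<close>-component of \<open>A\<close>, this is \<open>A = -L M\<close>.
\<close>

section \<open>Complex subspaces and conjugation\<close>

lemma csubspace_zero: "csubspace S \<Longrightarrow> 0 \<in> S"
  and csubspace_add: "csubspace S \<Longrightarrow> x \<in> S \<Longrightarrow> y \<in> S \<Longrightarrow> x + y \<in> S"
  and csubspace_scale: "csubspace S \<Longrightarrow> x \<in> S \<Longrightarrow> c *s x \<in> S"
  by (auto simp: csubspace_def)

lemma csubspace_neg: "csubspace S \<Longrightarrow> x \<in> S \<Longrightarrow> - x \<in> S"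
  using csubspace_scale[of S x "-1"] by simp

lemma csubspace_diff: "csubspace S \<Longrightarrow> x \<in> S \<Longrightarrow> y \<in> S \<Longrightarrow> x - y \<in> S"
  using csubspace_add[of S x "- y"] csubspace_neg[of S y] by simp

lemma csubspace_sum: "csubspace S \<Longrightarrow> (\<And>i. i \<in> A \<Longrightarrow> f i \<in> S) \<Longrightarrow> sum f A \<in> S"
  by (induction A rule: infinite_finite_induct) (auto simp: csubspace_zero csubspace_add)

lemma csubspace_Int: "csubspace S \<Longrightarrow> csubspace T \<Longrightarrow> csubspace (S \<inter> T)"
  by (auto simp: csubspace_def)

lemma csubspace_sumset:
  assumes "csubspace S" "csubspace T" shows "csubspace (sumset S T)"
  unfolding csubspace_def
proof (intro conjI ballI allI)
  show "0 \<in> sumset S T"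
    using csubspace_zero[OF assms(1)] csubspace_zero[OF assms(2)] by (force simp: sumset_def)
next
  fix x y assume "x \<in> sumset S T" "y \<in> sumset S T"
  then obtain a b c d where "x = a + b" "y = c + d" "a \<in> S" "b \<in> T" "c \<in> S" "d \<in> T"
    by (auto simp: sumset_def)
  then have "x + y = (a + c) + (b + d)" "a + c \<in> S" "b + d \<in> T"
    using assms csubspace_add by auto
  then show "x + y \<in> sumset S T" unfolding sumset_def by blast
next
  fix k x assume "x \<in> sumset S T"
  then obtain a b where "x = a + b" "a \<in> S" "b \<in> T" by (auto simp: sumset_def)
  then have "k *s x = k *s a + k *s b" "k *s a \<in> S" "k *s b \<in> T"
    using assms csubspace_scale by (auto simp: vector_add_ldistrib)
  then show "k *s x \<in> sumset S T" unfolding sumset_def by blast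
qed

lemma cvconj_zero [simp]: "cvconj 0 = 0"
  and cvconj_add: "cvconj (u + v) = cvconj u + cvconj v"
  and cvconj_diff: "cvconj (u - v) = cvconj u - cvconj v"
  and cvconj_scale: "cvconj (c *s v) = cnj c *s cvconj v"
  and cvconj_cvconj [simp]: "cvconj (cvconj v) = v"
  by (auto simp: cvconj_def vec_eq_iff)

lemma in_cvconj_image_iff: "v \<in> cvconj ` S \<longleftrightarrow> cvconj v \<in> S"
  by (metis cvconj_cvconj image_iff)

lemma csubspace_cvconj_vimage:
  "csubspace S \<Longrightarrow> csubspace {v. cvconj v \<in> S}"
  by (auto simp: csubspace_def cvconj_add cvconj_scale)

lemma cmconj_mul: "cmconj (A ** B) = cmconj A ** cmconj B"
  and cmconj_vector: "cvconj (A *v v) = cmconj A *v cvconj v"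
  and cmconj_diff: "cmconj (A - B) = cmconj A - cmconj B"
  and cmconj_cmconj [simp]: "cmconj (cmconj A) = A"
  and cmconj_mscale: "cmconj (mscale c A) = mscale (cnj c) (cmconj A)"
  and cmconj_mat_1 [simp]: "cmconj (mat 1) = mat 1"
  by (auto simp: cmconj_def cvconj_def matrix_matrix_mult_def matrix_vector_mult_def vec_eq_iff
        mscale_def mat_def)

lemma mscale_vector: "mscale c A *v v = c *s (A *v v)"
  by (auto simp: mscale_def matrix_vector_mult_def vec_eq_iff sum_distrib_left mult.assoc)

lemma csubspace_mimg:
  assumes "csubspace S" shows "csubspace (mimg g S)"
  unfolding csubspace_def mimg_def
proof (intro conjI ballI allI)
  show "0 \<in> (*v) g ` S" using csubspace_zero[OF assms] by (force simp: image_iff)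
  fix x assume "x \<in> (*v) g ` S"
  then obtain u where u: "x = g *v u" "u \<in> S" by auto
  { fix y assume "y \<in> (*v) g ` S"
    then obtain w where "y = g *v w" "w \<in> S" by auto
    with u show "x + y \<in> (*v) g ` S"
      using csubspace_add[OF assms] by (metis image_eqI vec.add) }
  show "c *s x \<in> (*v) g ` S" for c
    using u csubspace_scale[OF assms] by (metis image_eqI vec.scale)
qed

section \<open>Bigradings\<close>

definition bigrading :: "(int \<Rightarrow> int \<Rightarrow> ('n::finite) vecC set) \<Rightarrow> bool" where
  "bigrading I \<longleftrightarrow> (\<forall>p q. csubspace (I p q)) \<and>
     (\<forall>S x. finite S \<longrightarrow> (\<forall>(a, b)\<in>S. x (a, b) \<in> I a b) \<longrightarrow> sum x S = 0 \<longrightarrow> (\<forall>s\<in>S. x s = 0)) \<and>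
     isum I (\<lambda>a b. True) = UNIV"

text \<open>Acts as an induction principle for sums of pieces: a linear condition, written as a
  subspace \<open>K\<close>, has to be checked on the summands only.\<close>

lemma isum_least:
  assumes K: "csubspace K" and I: "\<And>p q v. R p q \<Longrightarrow> v \<in> I p q \<Longrightarrow> v \<in> K"
  shows "isum I R \<subseteq> K"
proof
  fix v assume "v \<in> isum I R"
  then obtain S x where "v = sum x S" "S \<subseteq> {(a, b). R a b}" "\<forall>(a, b)\<in>S. x (a, b) \<in> I a b"
    by (auto simp: isum_def)
  moreover from this have "x i \<in> K" if "i \<in> S" for i
    using that I by (cases i) blast
  ultimately show "v \<in> K" using csubspace_sum[OF K] by blast
qed

lemma isum_incl: "R p q \<Longrightarrow> v \<in> I p q \<Longrightarrow> v \<in> isum I R"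
  unfolding isum_def
  by (rule CollectI, rule exI[of _ "{(p, q)}"], rule exI[of _ "\<lambda>_. v"]) auto

lemma isum_csubspace:
  assumes "\<And>p q. csubspace (I p q)" shows "csubspace (isum I R)"
  unfolding csubspace_def
proof (intro conjI ballI allI)
  show "0 \<in> isum I R" unfolding isum_def by (intro CollectI exI[of _ "{}"]) auto
  fix u assume u: "u \<in> isum I R"
  then obtain S x where S: "u = sum x S" "finite S" "S \<subseteq> {(a, b). R a b}" "\<forall>(a, b)\<in>S. x (a, b) \<in> I a b"
    by (auto simp: isum_def)
  show "c *s u \<in> isum I R" for c
    using S csubspace_scale[OF assms]
    by (auto simp: isum_def vec.scale_sum_right intro!: exI[of _ S] exI[of _ "\<lambda>i. c *s x i"])
  fix v assume "v \<in> isum I R"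
  then obtain T y where T: "v = sum y T" "finite T" "T \<subseteq> {(a, b). R a b}" "\<forall>(a, b)\<in>T. y (a, b) \<in> I a b"
    by (auto simp: isum_def)
  let ?z = "\<lambda>i. (if i \<in> S then x i else 0) + (if i \<in> T then y i else 0)"
  have "u + v = sum ?z (S \<union> T)"
    using S(2) T(2) unfolding S(1) T(1) sum.distrib
    by (intro arg_cong2[where f = "(+)"] sum.mono_neutral_cong_left) auto
  moreover have "\<forall>(a, b)\<in>S \<union> T. ?z (a, b) \<in> I a b"
    using S(4) T(4) by (auto intro!: csubspace_add[OF assms] simp: csubspace_zero[OF assms])
  ultimately show "u + v \<in> isum I R"
    using S T unfolding isum_def by blast
qed

lemma isum_mono: "(\<And>p q. R p q \<Longrightarrow> R' p q) \<Longrightarrow> isum I R \<subseteq> isum I R'"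
  unfolding isum_def by blast

section \<open>Components of a vector with respect to a bigrading\<close>

definition is_bdecomp ::
    "(int \<Rightarrow> int \<Rightarrow> ('n::finite) vecC set) \<Rightarrow> (int \<times> int \<Rightarrow> 'n vecC) \<Rightarrow> 'n vecC \<Rightarrow> bool" where
  "is_bdecomp I x v \<longleftrightarrow> (\<forall>p q. x (p, q) \<in> I p q) \<and> finite {i. x i \<noteq> 0} \<and> v = sum x {i. x i \<noteq> 0}"

text \<open>The choice is among families on the whole index plane that vanish off a finite set, so
  no index set has to be carried along; \<open>bdecomp_unique\<close> shows that a bigrading leaves
  just one.\<close>

definition bproj :: "(int \<Rightarrow> int \<Rightarrow> ('n::finite) vecC set) \<Rightarrow> int \<Rightarrow> int \<Rightarrow> 'n vecC \<Rightarrow> 'n vecC" where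
  "bproj I p q v = (SOME x. is_bdecomp I x v) (p, q)"

lemma is_bdecomp_of_sum:
  assumes I: "\<And>p q. csubspace (I p q)"
    and S: "finite S" "\<forall>(a, b)\<in>S. x (a, b) \<in> I a b"
  shows "is_bdecomp I (\<lambda>i. if i \<in> S then x i else 0) (sum x S)"
  unfolding is_bdecomp_def
proof (intro conjI allI)
  show "(if (p, q) \<in> S then x (p, q) else 0) \<in> I p q" for p q
    using S(2) csubspace_zero[OF I] by auto
  show "finite {i. (if i \<in> S then x i else 0) \<noteq> 0}"
    by (rule finite_subset[OF _ S(1)]) auto
  show "sum x S = (\<Sum>i\<in>{i. (if i \<in> S then x i else 0) \<noteq> 0}. if i \<in> S then x i else 0)"
    by (rule sum.mono_neutral_cong_right[OF S(1)]) auto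
qed

lemma sum_bdecomp:
  assumes "is_bdecomp I x v" "finite T" "{i. x i \<noteq> 0} \<subseteq> T"
  shows "v = sum x T"
proof -
  have "v = sum x {i. x i \<noteq> 0}" using assms(1) by (simp add: is_bdecomp_def)
  also have "\<dots> = sum x T" by (rule sum.mono_neutral_left[OF assms(2,3)]) auto
  finally show ?thesis .
qed

context
  fixes I :: "int \<Rightarrow> int \<Rightarrow> ('n::finite) vecC set"
  assumes big: "bigrading I"
begin

lemma bigrading_csubspace: "csubspace (I p q)"
  using big by (simp add: bigrading_def)

lemma bigrading_direct:
  "finite S \<Longrightarrow> \<forall>(a, b)\<in>S. x (a, b) \<in> I a b \<Longrightarrow> sum x S = 0 \<Longrightarrow> \<forall>s\<in>S. x s = 0"
  using big unfolding bigrading_def by meson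

lemma bdecomp_unique:
  assumes x: "is_bdecomp I x v" and y: "is_bdecomp I y v"
  shows "x = y"
proof
  fix i
  let ?T = "{i. x i \<noteq> 0} \<union> {i. y i \<noteq> 0}"
  have fin: "finite ?T" using x y by (auto simp: is_bdecomp_def)
  have sum: "sum (\<lambda>i. x i - y i) ?T = 0"
    using sum_bdecomp[OF x fin] sum_bdecomp[OF y fin] by (simp add: sum_subtractf)
  have mem: "\<forall>(a, b)\<in>?T. x (a, b) - y (a, b) \<in> I a b"
    using x y csubspace_diff[OF bigrading_csubspace] by (auto simp: is_bdecomp_def)
  have "\<forall>i\<in>?T. x i - y i = 0"
    by (rule bigrading_direct[OF fin mem sum])
  then have "x i - y i = 0" if "x i \<noteq> 0 \<or> y i \<noteq> 0" using that by blast
  then show "x i = y i" by (cases "x i \<noteq> 0 \<or> y i \<noteq> 0") (blast intro: iffD2[OF eq_iff_diff_eq_0], simp)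
qed

lemma bdecomp_bproj: "is_bdecomp I (\<lambda>(p, q). bproj I p q v) v"
proof -
  have "v \<in> isum I (\<lambda>a b. True)" using big by (simp add: bigrading_def)
  then have "\<exists>x. is_bdecomp I x v"
    using is_bdecomp_of_sum[of I, OF bigrading_csubspace] by (auto simp: isum_def)
  then have "is_bdecomp I (SOME x. is_bdecomp I x v) v" by (rule someI_ex)
  moreover have "(\<lambda>(p, q). bproj I p q v) = (SOME x. is_bdecomp I x v)"
    by (auto simp: bproj_def fun_eq_iff)
  ultimately show ?thesis by simp
qed

lemma bproj_eqI: "is_bdecomp I x v \<Longrightarrow> bproj I p q v = x (p, q)"
  using bdecomp_unique[OF _ bdecomp_bproj, of x v] by simp

lemma bproj_in: "bproj I p q v \<in> I p q"
  using bdecomp_bproj[of v] by (auto simp: is_bdecomp_def)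

lemma bproj_add: "bproj I p q (u + v) = bproj I p q u + bproj I p q v"
proof -
  let ?x = "\<lambda>(p, q). bproj I p q u" and ?y = "\<lambda>(p, q). bproj I p q v"
  let ?T = "{i. ?x i \<noteq> 0} \<union> {i. ?y i \<noteq> 0}"
  have fin: "finite ?T" using bdecomp_bproj[of u] bdecomp_bproj[of v] by (auto simp: is_bdecomp_def)
  have "is_bdecomp I (\<lambda>i. if i \<in> ?T then ?x i + ?y i else 0) (sum (\<lambda>i. ?x i + ?y i) ?T)"
    by (rule is_bdecomp_of_sum[OF bigrading_csubspace fin])
      (use csubspace_add[OF bigrading_csubspace] bproj_in in auto)
  moreover have "sum (\<lambda>i. ?x i + ?y i) ?T = u + v"
    using sum_bdecomp[OF bdecomp_bproj fin, of u] sum_bdecomp[OF bdecomp_bproj fin, of v]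
    unfolding sum.distrib by simp
  ultimately show ?thesis
    using bproj_eqI[of "\<lambda>i. if i \<in> ?T then ?x i + ?y i else 0" "u + v" p q]
    by (cases "(p, q) \<in> ?T") simp_all
qed

lemma bproj_scale: "bproj I p q (c *s v) = c *s bproj I p q v"
proof -
  let ?x = "\<lambda>(p, q). bproj I p q v"
  let ?T = "{i. ?x i \<noteq> 0}"
  have fin: "finite ?T" using bdecomp_bproj[of v] by (auto simp: is_bdecomp_def)
  have "is_bdecomp I (\<lambda>i. if i \<in> ?T then c *s ?x i else 0) (sum (\<lambda>i. c *s ?x i) ?T)"
    by (rule is_bdecomp_of_sum[OF bigrading_csubspace fin])
      (use csubspace_scale[OF bigrading_csubspace] bproj_in in auto)
  moreover have "sum (\<lambda>i. c *s ?x i) ?T = c *s v"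
    using sum_bdecomp[OF bdecomp_bproj fin, of v] by (simp add: vec.scale_sum_right[symmetric])
  ultimately show ?thesis
    using bproj_eqI[of "\<lambda>i. if i \<in> ?T then c *s ?x i else 0" "c *s v" p q]
    by (cases "(p, q) \<in> ?T") simp_all
qed

lemma bproj_zero [simp]: "bproj I p q 0 = 0"
  using bproj_add[of p q 0 0] by simp

lemma bproj_diff: "bproj I p q (u - v) = bproj I p q u - bproj I p q v"
  using bproj_add[of p q "u - v" v] by (simp add: algebra_simps)

lemma bproj_sum: "bproj I p q (sum f A) = (\<Sum>i\<in>A. bproj I p q (f i))"
  by (induction A rule: infinite_finite_induct) (auto simp: bproj_add)

lemma bproj_of_mem:
  assumes "v \<in> I r s"
  shows "bproj I p q v = (if (p, q) = (r, s) then v else 0)"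
  using bproj_eqI[OF is_bdecomp_of_sum[of I "{(r, s)}" "\<lambda>_. v", OF bigrading_csubspace]] assms
  by auto

text \<open>Turns every partial sum of pieces into a vanishing condition on components, so that
  intersections of \<open>F\<close>, \<open>W\<close> and bidegree conditions reduce to logic on the
  indices.\<close>

lemma mem_isum_iff: "v \<in> isum I R \<longleftrightarrow> (\<forall>p q. \<not> R p q \<longrightarrow> bproj I p q v = 0)"
proof
  assume "v \<in> isum I R"
  then show "\<forall>p q. \<not> R p q \<longrightarrow> bproj I p q v = 0"
  proof -
    have "isum I R \<subseteq> {v. \<forall>p q. \<not> R p q \<longrightarrow> bproj I p q v = 0}"
      by (rule isum_least) (auto simp: csubspace_def bproj_add bproj_scale bproj_of_mem)
    with \<open>v \<in> isum I R\<close> show ?thesis by blast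
  qed
next
  assume *: "\<forall>p q. \<not> R p q \<longrightarrow> bproj I p q v = 0"
  let ?x = "\<lambda>(p, q). bproj I p q v"
  have "finite {i. ?x i \<noteq> 0}" "v = sum ?x {i. ?x i \<noteq> 0}"
    using bdecomp_bproj[of v] by (auto simp: is_bdecomp_def)
  then show "v \<in> isum I R"
    unfolding isum_def using * bproj_in
    by (intro CollectI exI[of _ "{i. ?x i \<noteq> 0}"] exI[of _ ?x]) auto
qed

lemma csubspace_isum: "csubspace (isum I R)"
  by (rule isum_csubspace[OF bigrading_csubspace])

lemma mem_iff_bproj: "v \<in> I p q \<longleftrightarrow> (\<forall>r s. (r, s) \<noteq> (p, q) \<longrightarrow> bproj I r s v = 0)"
proof
  assume "\<forall>r s. (r, s) \<noteq> (p, q) \<longrightarrow> bproj I r s v = 0"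
  then have "v \<in> isum I (\<lambda>r s. (r, s) = (p, q))" by (auto simp: mem_isum_iff)
  moreover have "isum I (\<lambda>r s. (r, s) = (p, q)) \<subseteq> I p q"
    by (rule isum_least[OF bigrading_csubspace]) auto
  ultimately show "v \<in> I p q" by blast
qed (auto simp: bproj_of_mem)

lemma bigrading_all:
  assumes "csubspace K" "\<And>p q v. v \<in> I p q \<Longrightarrow> v \<in> K"
  shows "v \<in> K"
  using isum_least[OF assms(1), of "\<lambda>_ _. True" I] assms(2) big by (auto simp: bigrading_def)

lemma bproj_all_zero: "(\<And>p q. bproj I p q v = 0) \<Longrightarrow> v = 0"
  using mem_iff_bproj[of v 0 0] bproj_of_mem[of v 0 0 0 0] by simp

text \<open>Finite dimension enters here: each coordinate vector has finitely many nonzero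
  components, and the union over these vectors serves for all.\<close>

lemma bigrading_finite_support:
  obtains T where "finite T" "\<And>p q v. (p, q) \<notin> T \<Longrightarrow> bproj I p q v = 0"
proof -
  let ?T = "\<Union>j\<in>UNIV. {(p, q). bproj I p q (axis j 1) \<noteq> 0}"
  have "finite ?T"
    using bdecomp_bproj by (auto simp: is_bdecomp_def case_prod_beta')
  moreover have "bproj I p q v = 0" if "(p, q) \<notin> ?T" for p q v
  proof -
    have "v = (\<Sum>j\<in>UNIV. v $ j *s axis j 1)" by (simp add: basis_expansion)
    then have "bproj I p q v = (\<Sum>j\<in>UNIV. v $ j *s bproj I p q (axis j 1))"
      by (metis (no_types, lifting) bproj_scale bproj_sum sum.cong)
    with that show ?thesis by simp
  qed
  ultimately show thesis by (rule that)
qed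

text \<open>Justifies the definite description in \<open>Yop\<close>: the operator is the finite sum
  of the projections weighted by \<open>p + q\<close>.\<close>

lemma bigrading_weight_operator:
  "\<exists>!Y. \<forall>p q. \<forall>v\<in>I p q. Y *v v = of_int (p + q) *s v"
proof -
  obtain T where T: "finite T" "\<And>p q v. (p, q) \<notin> T \<Longrightarrow> bproj I p q v = 0"
    using bigrading_finite_support by blast
  define f where "f v = (\<Sum>(p, q)\<in>T. of_int (p + q) *s bproj I p q v)" for v :: "'n vecC"
  have "Vector_Spaces.linear (*s) (*s) f"
    by unfold_locales
      (auto simp: f_def bproj_add bproj_scale vector_add_ldistrib sum.distrib case_prod_beta'
        vec.scale_sum_right mult.commute simp del: of_int_add intro!: sum.cong)
  then have f: "matrix f *v v = f v" for v by (simp add: matrix_works)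
  have "matrix f *v v = of_int (p + q) *s v" if v: "v \<in> I p q" for p q v
  proof (cases "(p, q) \<in> T")
    case True
    have "f v = (\<Sum>i\<in>T. if i = (p, q) then of_int (p + q) *s v else 0)"
      unfolding f_def by (rule sum.cong) (auto simp: bproj_of_mem[OF v] simp del: of_int_add split: if_splits)
    with True T(1) f show ?thesis by simp
  next
    case False
    then have "v = 0" using T(2) bproj_of_mem[OF v, of p q] by auto
    then show ?thesis by simp
  qed
  moreover have "Y = Z" if "\<forall>p q. \<forall>v\<in>I p q. Y *v v = of_int (p + q) *s v"
    "\<forall>p q. \<forall>v\<in>I p q. Z *v v = of_int (p + q) *s v" for Y Z :: "'n matC"
  proof -
    have "v \<in> {v. Y *v v = Z *v v}" for v
      by (rule bigrading_all) (use that in \<open>auto simp: csubspace_def vec.add vec.scale\<close>)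
    then show ?thesis by (simp add: matrix_eq)
  qed
  ultimately show ?thesis by blast
qed

end

text \<open>Replaces a dimension count: the two families of projections agree on the pieces of
  \<open>J\<close>, hence everywhere by linearity.\<close>

lemma bigrading_le_imp_eq:
  assumes I: "bigrading I" and J: "bigrading J" and le: "\<And>p q. J p q \<subseteq> I p q"
  shows "J = I"
proof -
  have *: "bproj I p q v = bproj J p q v" for p q v
  proof -
    have "v \<in> {v. bproj I p q v = bproj J p q v}"
      by (rule bigrading_all[OF J])
        (use le in \<open>auto simp: csubspace_def bproj_add[OF I] bproj_add[OF J] bproj_zero[OF I] bproj_zero[OF J]
          bproj_scale[OF I] bproj_scale[OF J] bproj_of_mem[OF J] bproj_of_mem[OF I subsetD[OF le]]\<close>)
    then show ?thesis by simp
  qed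
  show ?thesis
    by (intro ext set_eqI) (simp add: mem_iff_bproj[OF I] mem_iff_bproj[OF J] *)
qed

section \<open>The Deligne bigrading of a mixed Hodge structure\<close>

text \<open>The Hodge structures on the graded quotients are expressed by vectors instead of
  quotient spaces: \<open>hodge_sum\<close> and \<open>hodge_inter\<close> say that \<open>F\<close>
  and its conjugate are opposed in weight \<open>k\<close>, the indices \<open>p\<close> and
  \<open>k - p + 1\<close> adding up to \<open>k + 1\<close>.\<close>

locale mixed_hodge =
  fixes W F :: "int \<Rightarrow> ('n::finite) vecC set"
  assumes W_csubspace: "csubspace (W k)"
    and W_step: "W k \<subseteq> W (k + 1)"
    and W_bounds: "\<exists>k0 k1. W k0 = {0} \<and> W k1 = UNIV"
    and W_conj: "v \<in> W k \<Longrightarrow> cvconj v \<in> W k"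
    and F_csubspace: "csubspace (F p)"
    and F_step: "F (p + 1) \<subseteq> F p"
    and F_bounds: "\<exists>p0 p1. F p0 = UNIV \<and> F p1 = {0}"
    and hodge_sum: "v \<in> W k \<Longrightarrow> \<exists>f g. f \<in> F p \<and> f \<in> W k \<and> cvconj g \<in> F (k - p + 1) \<and> g \<in> W k
          \<and> v - f - g \<in> W (k - 1)"
    and hodge_inter: "v \<in> W k \<Longrightarrow> f \<in> F p \<Longrightarrow> v - f \<in> W (k - 1) \<Longrightarrow>
          cvconj g \<in> F (k - p + 1) \<Longrightarrow> v - g \<in> W (k - 1) \<Longrightarrow> v \<in> W (k - 1)"
begin

section \<open>Elementary rules for the two filtrations\<close>

lemma W_mono: "k \<le> l \<Longrightarrow> W k \<subseteq> W l"
  by (induction l rule: int_ge_induct) (use W_step in auto)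

lemma W_monoD: "v \<in> W k \<Longrightarrow> k \<le> l \<Longrightarrow> v \<in> W l"
  using W_mono by blast

lemma F_antimonoD: "v \<in> F q \<Longrightarrow> p \<le> q \<Longrightarrow> v \<in> F p"
proof -
  have "p \<le> q \<Longrightarrow> F q \<subseteq> F p"
    by (induction q rule: int_ge_induct) (use F_step in auto)
  then show "v \<in> F q \<Longrightarrow> p \<le> q \<Longrightarrow> v \<in> F p" by blast
qed

lemma W_zero [simp]: "0 \<in> W k" and F_zero [simp]: "0 \<in> F k"
  by (auto simp: csubspace_zero W_csubspace F_csubspace)

lemmas W_add = csubspace_add[OF W_csubspace] and W_diff = csubspace_diff[OF W_csubspace]
  and F_add = csubspace_add[OF F_csubspace] and F_diff = csubspace_diff[OF F_csubspace]
  and W_neg = csubspace_neg[OF W_csubspace] and F_neg = csubspace_neg[OF F_csubspace]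
  and W_scale = csubspace_scale[OF W_csubspace] and F_scale = csubspace_scale[OF F_csubspace]

lemma W_conj_iff: "cvconj v \<in> W k \<longleftrightarrow> v \<in> W k"
  using W_conj cvconj_cvconj by metis

lemma W_minus_commute: "v - w \<in> W k \<Longrightarrow> w - v \<in> W k"
  using W_neg[of "v - w"] by simp

lemma W_of_diff: "u \<in> W k \<Longrightarrow> u - w \<in> W l \<Longrightarrow> l \<le> k \<Longrightarrow> w \<in> W k"
  using W_diff[of u k "u - w"] W_monoD[of "u - w" l k] by simp

lemma W_diff_trans: "u - v \<in> W k \<Longrightarrow> v - w \<in> W k \<Longrightarrow> u - w \<in> W k"
  using W_add[of "u - v" k "v - w"] by simp

text \<open>Closed forms of Deligne's sums
  \<open>\<Sum>j\<ge>0. conj F\<^bsup>r-j\<^esup> \<inter> W\<^bsub>l-j\<^esub>\<close> and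
  \<open>conj F\<^bsup>q\<^esup> \<inter> W\<^bsub>k\<^esub> + \<Sum>j\<ge>1. conj F\<^bsup>q-j\<^esup> \<inter> W\<^bsub>k-j-1\<^esub>\<close>, phrased as approximation conditions
  so that no summation is needed.\<close>

definition conj_F_sum :: "int \<Rightarrow> int \<Rightarrow> 'n vecC set" where
  "conj_F_sum r l = {v \<in> W l. \<forall>n::nat. \<exists>c. cvconj c \<in> F (r - int n) \<and> v - c \<in> W (l - int n - 1)}"

definition conj_F_sum' :: "int \<Rightarrow> int \<Rightarrow> 'n vecC set" where
  "conj_F_sum' q k = {v \<in> W k. \<forall>n::nat. \<exists>c. cvconj c \<in> F (q - int n) \<and> v - c \<in> W (k - int n - 2)}"

text \<open>Deligne's formula for \<open>I^{p,q}\<close>: the intersection of \<open>F p\<close> and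
  \<open>W (p + q)\<close> with the second sum above; the condition on \<open>W\<close> is part of
  \<open>conj_F_sum'\<close>.\<close>

definition deligne_space :: "int \<Rightarrow> int \<Rightarrow> 'n vecC set" where
  "deligne_space p q = F p \<inter> conj_F_sum' q (p + q)"

section \<open>Deligne's subspaces: linearity and generators\<close>

lemma csubspace_approx:
  "csubspace {v. \<forall>n::nat. \<exists>c. cvconj c \<in> F (f n) \<and> v - c \<in> W (g n)}"
  unfolding csubspace_def
proof (intro conjI ballI allI CollectI)
  show "\<exists>c. cvconj c \<in> F (f n) \<and> 0 - c \<in> W (g n)" for n
    by (rule exI[of _ 0]) simp
next
  fix x y n
  assume "x \<in> {v. \<forall>n::nat. \<exists>c. cvconj c \<in> F (f n) \<and> v - c \<in> W (g n)}"
    "y \<in> {v. \<forall>n::nat. \<exists>c. cvconj c \<in> F (f n) \<and> v - c \<in> W (g n)}"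
  then obtain c d where "cvconj c \<in> F (f n)" "x - c \<in> W (g n)" "cvconj d \<in> F (f n)" "y - d \<in> W (g n)"
    by blast
  then show "\<exists>c. cvconj c \<in> F (f n) \<and> x + y - c \<in> W (g n)"
    using F_add[of "cvconj c" _ "cvconj d"] W_add[of "x - c" _ "y - d"]
    by (intro exI[of _ "c + d"]) (simp add: cvconj_add algebra_simps)
next
  fix a x n
  assume "x \<in> {v. \<forall>n::nat. \<exists>c. cvconj c \<in> F (f n) \<and> v - c \<in> W (g n)}"
  then obtain c where "cvconj c \<in> F (f n)" "x - c \<in> W (g n)" by blast
  then show "\<exists>c. cvconj c \<in> F (f n) \<and> a *s x - c \<in> W (g n)"
    using F_scale[of "cvconj c" _ "cnj a"] W_scale[of "x - c" _ a]
    by (intro exI[of _ "a *s c"]) (simp add: cvconj_scale vec.scale_right_diff_distrib)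
qed

lemma csubspace_conj_F_sum: "csubspace (conj_F_sum r l)"
  using csubspace_Int[OF W_csubspace csubspace_approx] unfolding conj_F_sum_def
  by (simp add: Int_def)

lemma csubspace_conj_F_sum': "csubspace (conj_F_sum' q k)"
  using csubspace_Int[OF W_csubspace csubspace_approx] unfolding conj_F_sum'_def
  by (simp add: Int_def)

lemma csubspace_deligne_space: "csubspace (deligne_space p q)"
  unfolding deligne_space_def by (intro csubspace_Int F_csubspace csubspace_conj_F_sum')

lemma deligne_space_F: "v \<in> deligne_space p q \<Longrightarrow> v \<in> F p" and deligne_space_conj_F_sum': "v \<in> deligne_space p q \<Longrightarrow> v \<in> conj_F_sum' q (p + q)"
  by (auto simp: deligne_space_def)

lemma deligne_space_W: "v \<in> deligne_space p q \<Longrightarrow> v \<in> W (p + q)"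
  by (auto simp: deligne_space_def conj_F_sum'_def)

lemma conj_F_sum'_I0: "cvconj c \<in> F q \<Longrightarrow> c \<in> W k \<Longrightarrow> c \<in> conj_F_sum' q k"
  unfolding conj_F_sum'_def using F_antimonoD by (auto intro!: exI[of _ c])

text \<open>A generator of Deligne's sum meets all approximation conditions: for
  \<open>n < j\<close> it lies deep enough in \<open>W\<close> to be approximated by
  \<open>0\<close>, and from \<open>n = j\<close> on it approximates itself.\<close>

lemma conj_F_sum'_I:
  assumes "cvconj c \<in> F (q - int j)" "c \<in> W (k - int j - 1)"
  shows "c \<in> conj_F_sum' q k"
proof -
  have "\<exists>d. cvconj d \<in> F (q - int n) \<and> c - d \<in> W (k - int n - 2)" for n
  proof (cases "n < j")
    case True
    with assms(2) show ?thesis by (intro exI[of _ 0]) (auto intro: W_monoD)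
  next
    case False
    with assms(1) show ?thesis by (intro exI[of _ c]) (auto intro: F_antimonoD)
  qed
  with assms(2) show ?thesis unfolding conj_F_sum'_def by (auto intro: W_monoD)
qed

section \<open>Comparison of the Deligne spaces with the graded quotients\<close>

lemma eq_zero_if_all_W:
  assumes "v \<in> W k" "\<And>m. v \<in> W (k - int m) \<Longrightarrow> v \<in> W (k - int m - 1)"
  shows "v = 0"
proof -
  obtain k0 where k0: "W k0 = {0}" using W_bounds by blast
  have "v \<in> W (k - int m)" for m
    by (induction m) (use assms in \<open>auto simp: algebra_simps\<close>)
  then have "v \<in> W (k - int (nat (k - k0)))" .
  then have "v \<in> W k0 \<or> k \<le> k0" by (cases "k \<ge> k0") auto
  then have "v \<in> W k0" using W_monoD[OF assms(1)] by blast
  with k0 show ?thesis by simp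
qed

text \<open>Descent through \<open>W\<close>: in weight \<open>p + q - 1 - m\<close> the vector lies
  in \<open>F p\<close> and is congruent to one in the conjugate of \<open>F (q - m)\<close>. These
  indices add up to the weight plus one, so opposedness lowers the weight again.\<close>

lemma deligne_space_inj:
  assumes v: "v \<in> deligne_space p q" and lower: "v \<in> W (p + q - 1)"
  shows "v = 0"
proof (rule eq_zero_if_all_W[OF lower])
  fix m assume m: "v \<in> W (p + q - 1 - int m)"
  obtain c where c: "cvconj c \<in> F (q - int m)" "v - c \<in> W (p + q - int m - 2)"
    using deligne_space_conj_F_sum'[OF v] unfolding conj_F_sum'_def by blast
  show "v \<in> W (p + q - 1 - int m - 1)"
    by (rule hodge_inter[OF m deligne_space_F[OF v], of c]) (use c in \<open>auto simp: algebra_simps\<close>)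
qed

text \<open>Successive correction: \<open>v\<close> in \<open>F p\<close> and \<open>w\<close> in
  Deligne's sum agree up to \<open>W (p + q - 1 - m)\<close>. Opposedness splits the difference; one
  part is taken off \<open>v\<close>, the other added to \<open>w\<close>, and the agreement
  improves by one step until it is equality.\<close>

lemma deligne_space_surj:
  assumes u: "u \<in> F p" "u \<in> W (p + q)" and w: "cvconj w \<in> F q" "u - w \<in> W (p + q - 1)"
  obtains v where "v \<in> deligne_space p q" "v - u \<in> W (p + q - 1)"
proof -
  let ?k = "p + q"
  have "\<exists>v w. v \<in> F p \<and> v \<in> W ?k \<and> v - u \<in> W (?k - 1) \<and> w \<in> conj_F_sum' q ?k \<and> v - w \<in> W (?k - 1 - int m)" for m
  proof (induction m)
    case 0
    have "w \<in> conj_F_sum' q ?k" using w W_of_diff[OF u(2) w(2)] by (intro conj_F_sum'_I0) auto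
    with u w show ?case by (intro exI[of _ u] exI[of _ w]) auto
  next
    case (Suc m)
    then obtain v w where vw: "v \<in> F p" "v \<in> W ?k" "v - u \<in> W (?k - 1)" "w \<in> conj_F_sum' q ?k"
      "v - w \<in> W (?k - 1 - int m)" by blast
    obtain f g where fg: "f \<in> F p" "f \<in> W (?k - 1 - int m)" "cvconj g \<in> F (?k - 1 - int m - p + 1)"
      "g \<in> W (?k - 1 - int m)" "v - w - f - g \<in> W (?k - 1 - int m - 1)"
      using hodge_sum[OF vw(5)] by blast
    \<comment> \<open>The index \<open>?k - 1 - m - p + 1\<close> equals \<open>q - m\<close>, so
      this correction is a generator with \<open>j = m\<close>.\<close>
    have "g \<in> conj_F_sum' q ?k"
      by (rule conj_F_sum'_I[of _ _ m]) (use fg in \<open>auto simp: algebra_simps\<close>)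
    then have "w + g \<in> conj_F_sum' q ?k" using vw csubspace_add[OF csubspace_conj_F_sum'] by blast
    moreover have "v - f \<in> W ?k" using vw fg by (intro W_diff) (auto intro: W_monoD)
    moreover have "v - u - f \<in> W (?k - 1)" using W_diff[OF vw(3) W_monoD[OF fg(2)]] by simp
    ultimately show ?case
      using fg vw F_diff by (intro exI[of _ "v - f"] exI[of _ "w + g"]) (auto simp: algebra_simps)
  qed
  note approx = this
  obtain k0 where k0: "W k0 = {0}" using W_bounds by blast
  obtain v w' where v: "v \<in> F p" "v \<in> W ?k" "v - u \<in> W (?k - 1)" "w' \<in> conj_F_sum' q ?k"
      "v - w' \<in> W (?k - 1 - int (nat (?k - k0)))" using approx by blast
  have "v - w' \<in> W k0" using v(5) by (rule W_monoD) auto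
  then have "v = w'" using k0 by simp
  then show thesis using v that by (auto simp: deligne_space_def)
qed

text \<open>Conjugation exchanges the Hodge types on the graded quotient. The approximation with
  \<open>n = 0\<close> exhibits a representative in \<open>F q\<close>, which
  \<open>deligne_space_surj\<close> lifts to the Deligne space.\<close>

lemma conj_deligne_space_mod:
  assumes "x \<in> deligne_space p q"
  obtains y where "y \<in> deligne_space q p" "cvconj x - y \<in> W (p + q - 1)"
proof -
  obtain c where c: "cvconj c \<in> F q" "x - c \<in> W (p + q - 2)"
    using deligne_space_conj_F_sum'[OF assms] unfolding conj_F_sum'_def by (auto dest!: spec[of _ 0])
  have d: "cvconj c - cvconj x \<in> W (p + q - 1)"
    using c(2) by (simp add: cvconj_diff[symmetric] W_conj_iff) (meson W_minus_commute W_monoD diff_left_mono one_le_numeral)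
  have "cvconj c \<in> W (q + p)" using W_of_diff[OF deligne_space_W[OF assms] c(2)] by (simp add: W_conj_iff add.commute)
  then obtain y where "y \<in> deligne_space q p" "y - cvconj c \<in> W (q + p - 1)"
    using deligne_space_surj[of "cvconj c" q p "cvconj x"] c d deligne_space_F[OF assms] by (auto simp: add.commute)
  with d that show thesis
    by (metis W_diff_trans W_minus_commute add.commute)
qed

section \<open>Decomposition of the space and of both filtrations\<close>

lemma F_W_step:
  assumes v: "v \<in> F p" "v \<in> W k"
  obtains x f w where "x \<in> deligne_space p (k - p)" "f \<in> F (p + 1)" "f \<in> W k" "w \<in> F p" "w \<in> W (k - 1)"
    "v = x + f + w"
proof -
  obtain f g where fg: "f \<in> F (p + 1)" "f \<in> W k" "cvconj g \<in> F (k - (p + 1) + 1)" "g \<in> W k"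
    "v - f - g \<in> W (k - 1)" using hodge_sum[OF v(2)] by blast
  have f: "f \<in> F p" using fg(1) by (rule F_antimonoD) simp
  \<comment> \<open>Opposedness was used for \<open>F (p + 1)\<close> and the conjugate of
    \<open>F (k - p)\<close>, so \<open>v - f\<close> lies in \<open>F p\<close> and is congruent to
    \<open>g\<close>: it has Hodge type \<open>(p, k - p)\<close>.\<close>
  obtain x where x: "x \<in> deligne_space p (k - p)" "x - (v - f) \<in> W (k - 1)"
    using deligne_space_surj[of "v - f" p "k - p" g] fg v F_diff[OF v(1) f] W_diff[OF v(2) fg(2)] by auto
  have "v - x - f \<in> F p" using v f x deligne_space_F F_diff by blast
  moreover have "v - x - f \<in> W (k - 1)" using W_minus_commute[OF x(2)] by (simp add: algebra_simps)
  ultimately show thesis using that[of x f "v - x - f"] x fg by simp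
qed

text \<open>Leading term argument: among the nonzero terms of maximal weight \<open>k\<close>, take
  the one with minimal first index \<open>p\<close>. All others lie in \<open>F (p + 1)\<close> plus
  \<open>W (k - 1)\<close>, so modulo \<open>W (k - 1)\<close> this term lies both in
  \<open>F (p + 1)\<close> and in the conjugate of \<open>F (k - p)\<close>. It then has weight
  below \<open>k\<close> and vanishes by \<open>deligne_space_inj\<close>.\<close>

lemma deligne_space_direct:
  assumes T: "finite T" "\<forall>(a, b)\<in>T. x (a, b) \<in> deligne_space a b" "sum x T = 0"
  shows "\<forall>s\<in>T. x s = 0"
proof (rule ccontr)
  assume nz: "\<not> (\<forall>s\<in>T. x s = 0)"
  define N where "N = {s \<in> T. x s \<noteq> 0}"
  have N: "finite N" "N \<noteq> {}" "sum x N = 0"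
  proof -
    show "sum x N = 0"
      unfolding N_def using T(3) by (subst sum.mono_neutral_left[OF T(1)]) auto
  qed (use nz T(1) in \<open>auto simp: N_def\<close>)
  define k where "k = Max ((\<lambda>(a, b). a + b) ` N)"
  have k: "a + b \<le> k" if "(a, b) \<in> N" for a b
    unfolding k_def using N that by (intro Max_ge) force+
  define N' where "N' = {(a, b) \<in> N. a + b = k}"
  have "k \<in> (\<lambda>(a, b). a + b) ` N" unfolding k_def using N by (intro Max_in) auto
  then have N': "finite N'" "N' \<noteq> {}"
    using finite_subset[OF _ N(1), of N'] by (auto simp: N'_def)
  define p where "p = Min (fst ` N')"
  have p: "p \<le> a" if "(a, b) \<in> N'" for a b
    unfolding p_def using N' that by (intro Min_le) force+
  have "p \<in> fst ` N'" unfolding p_def using N' by (intro Min_in) auto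
  then have pN: "(p, k - p) \<in> N" by (auto simp: N'_def)
  let ?s = "(p, k - p)"
  have mem: "x (a, b) \<in> deligne_space a b" if "(a, b) \<in> N" for a b using that T(2) by (auto simp: N_def)
  have xs: "x ?s \<in> deligne_space p (k - p)" using mem[OF pN] .
  have "csubspace (sumset (F (p + 1)) (W (k - 1)))"
    by (intro csubspace_sumset F_csubspace W_csubspace)
  moreover have "x s \<in> sumset (F (p + 1)) (W (k - 1))" if s: "s \<in> N - {?s}" for s
  proof -
    obtain a b where ab: "s = (a, b)" by fastforce
    have x: "x s \<in> deligne_space a b" using s ab mem by auto
    show ?thesis
    proof (cases "a + b = k")
      case True
      then have "p \<le> a" using p[of a b] s ab by (auto simp: N'_def)
      moreover have "a \<noteq> p" using s ab True by auto
      ultimately have "x s \<in> F (p + 1)" using F_antimonoD[OF deligne_space_F[OF x]] by simp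
      then show ?thesis unfolding sumset_def using W_zero by force
    next
      case False
      then have "x s \<in> W (k - 1)" using k[of a b] s ab W_monoD[OF deligne_space_W[OF x]] by auto
      then show ?thesis unfolding sumset_def using F_zero by force
    qed
  qed
  ultimately have "sum x (N - {?s}) \<in> sumset (F (p + 1)) (W (k - 1))"
    by (rule csubspace_sum)
  then obtain f w where fw: "sum x (N - {?s}) = f + w" "f \<in> F (p + 1)" "w \<in> W (k - 1)"
    by (auto simp: sumset_def)
  have "x ?s = - f - w"
    using N pN fw(1) by (simp add: sum.remove[of N ?s] algebra_simps eq_neg_iff_add_eq_0)
  then have f: "x ?s - (- f) \<in> W (k - 1)" using W_neg[OF fw(3)] by simp
  obtain c where c: "cvconj c \<in> F (k - p)" "x ?s - c \<in> W (k - 2)"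
    using deligne_space_conj_F_sum'[OF xs] unfolding conj_F_sum'_def by (auto dest!: spec[of _ 0])
  have "x ?s \<in> W (k - 1)"
    by (rule hodge_inter[of _ k "- f" "p + 1" c])
      (use deligne_space_W[OF xs] F_neg[OF fw(2)] f c in \<open>auto intro: W_monoD\<close>)
  then have "x ?s = 0" using deligne_space_inj[OF xs] by simp
  with pN show False by (simp add: N_def)
qed


text \<open>Both bounds are kept at once because \<open>F_W_step\<close> leaves two remainders, one
  further in \<open>F\<close> and one lower in \<open>W\<close>; the distances to the ends of the
  two filtrations drive the induction.\<close>

lemma F_W_isum: "v \<in> F p \<Longrightarrow> v \<in> W k \<Longrightarrow> v \<in> isum deligne_space (\<lambda>a b. a \<ge> p \<and> a + b \<le> k)"
proof -
  obtain k0 p1 where k0: "W k0 = {0}" and p1: "F p1 = {0}" using W_bounds F_bounds by blast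
  have zero: "0 \<in> isum deligne_space R" for R
    unfolding isum_def by (intro CollectI exI[of _ "{}"]) auto
  show "v \<in> F p \<Longrightarrow> v \<in> W k \<Longrightarrow> v \<in> isum deligne_space (\<lambda>a b. a \<ge> p \<and> a + b \<le> k)"
  proof (induction "nat (p1 - p) + nat (k - k0)" arbitrary: v p k rule: less_induct)
    case less
    let ?R = "\<lambda>a b. a \<ge> p \<and> a + b \<le> k"
    show ?case
    proof (cases "p \<ge> p1 \<or> k \<le> k0")
      case True
      then have "v = 0" using less.prems F_antimonoD[of v p p1] W_monoD[of v k k0] k0 p1 by auto
      then show ?thesis using zero by simp
    next
      case False
      obtain x f w where d: "x \<in> deligne_space p (k - p)" "f \<in> F (p + 1)" "f \<in> W k" "w \<in> F p" "w \<in> W (k - 1)"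
        "v = x + f + w" using F_W_step[OF less.prems] by blast
      have "f \<in> isum deligne_space (\<lambda>a b. a \<ge> p + 1 \<and> a + b \<le> k)"
        by (rule less.hyps) (use d False in auto)
      then have f: "f \<in> isum deligne_space ?R"
        by (rule subsetD[OF isum_mono, rotated]) auto
      have "w \<in> isum deligne_space (\<lambda>a b. a \<ge> p \<and> a + b \<le> k - 1)"
        by (rule less.hyps) (use d False in auto)
      then have w: "w \<in> isum deligne_space ?R"
        by (rule subsetD[OF isum_mono, rotated]) auto
      have x: "x \<in> isum deligne_space ?R" using d(1) by (intro isum_incl[of _ p "k - p"]) auto
      show ?thesis using x f w d(6) csubspace_add[OF isum_csubspace[of deligne_space ?R, OF csubspace_deligne_space]] by blast
    qed
  qed
qed

lemma bigrading_deligne_space: "bigrading deligne_space"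
  unfolding bigrading_def
proof (intro conjI allI impI)
  show "csubspace (deligne_space p q)" for p q by (rule csubspace_deligne_space)
  show "\<forall>s\<in>T. x s = 0" if "finite T" "\<forall>(a, b)\<in>T. x (a, b) \<in> deligne_space a b" "sum x T = 0" for T x
    using deligne_space_direct[OF that] .
  obtain k1 p0 where "W k1 = UNIV" "F p0 = UNIV" using W_bounds F_bounds by blast
  then have "v \<in> isum deligne_space (\<lambda>a b. a \<ge> p0 \<and> a + b \<le> k1)" for v
    using F_W_isum[of v p0 k1] by simp
  then show "isum deligne_space (\<lambda>a b. True) = UNIV"
    using isum_mono[of "\<lambda>a b. a \<ge> p0 \<and> a + b \<le> k1" "\<lambda>a b. True" deligne_space] by blast
qed

lemma F_eq_isum: "F p = isum deligne_space (\<lambda>a b. a \<ge> p)"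
proof
  obtain k1 where "W k1 = UNIV" using W_bounds by blast
  then show "F p \<subseteq> isum deligne_space (\<lambda>a b. a \<ge> p)"
    using F_W_isum[of _ p k1] isum_mono[of "\<lambda>a b. a \<ge> p \<and> a + b \<le> k1" "\<lambda>a b. a \<ge> p" deligne_space] by blast
  show "isum deligne_space (\<lambda>a b. a \<ge> p) \<subseteq> F p"
    by (rule isum_least[OF F_csubspace]) (use deligne_space_F F_antimonoD in blast)
qed

lemma W_eq_isum: "W k = isum deligne_space (\<lambda>a b. a + b \<le> k)"
proof
  obtain p0 where "F p0 = UNIV" using F_bounds by blast
  then show "W k \<subseteq> isum deligne_space (\<lambda>a b. a + b \<le> k)"
    using F_W_isum[of _ p0 k] isum_mono[of "\<lambda>a b. a \<ge> p0 \<and> a + b \<le> k" "\<lambda>a b. a + b \<le> k" deligne_space] by blast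
  show "isum deligne_space (\<lambda>a b. a + b \<le> k) \<subseteq> W k"
    by (rule isum_least[OF W_csubspace]) (use deligne_space_W W_monoD in blast)
qed

section \<open>Conjugation of the Deligne spaces\<close>

lemma deligne_space_sub_conj_F_sum:
  assumes x: "x \<in> deligne_space a b" and ab: "a + b \<le> l" "a \<le> l - r"
  shows "x \<in> conj_F_sum r l"
proof -
  have "\<exists>c. cvconj c \<in> F (r - int n) \<and> x - c \<in> W (l - int n - 1)" for n
  proof (cases "int n < l - a - b")
    case True
    with deligne_space_W[OF x] show ?thesis by (intro exI[of _ 0]) (auto intro: W_monoD)
  next
    case False
    \<comment> \<open>The piece sits \<open>l - a - b\<close> steps below \<open>l\<close>, so its
      own approximation is used with a shifted index, chosen to make
      \<open>a + b - m = l - n\<close>.\<close>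
    define m where "m = nat (int n - (l - a - b))"
    have m: "int m = int n - (l - a - b)" using False by (simp add: m_def)
    obtain c where "cvconj c \<in> F (b - int m)" "x - c \<in> W (a + b - int m - 2)"
      using deligne_space_conj_F_sum'[OF x] unfolding conj_F_sum'_def by blast
    then show ?thesis using ab m by (intro exI[of _ c]) (auto intro: W_monoD F_antimonoD)
  qed
  with deligne_space_W[OF x] ab show ?thesis unfolding conj_F_sum_def by (auto intro: W_monoD)
qed

text \<open>Descent in the weight \<open>l - m\<close>: the conjugate of an approximant is
  decomposed, and its pieces of top weight, conjugated back, are Deligne pieces with exchanged
  indices modulo lower weight. Subtracting them lowers the weight.\<close>

lemma conj_F_sum_sub_isum: "conj_F_sum r l \<subseteq> isum deligne_space (\<lambda>a b. a + b \<le> l \<and> a \<le> l - r)"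
proof -
  let ?T = "isum deligne_space (\<lambda>a b. a + b \<le> l \<and> a \<le> l - r)"
  obtain k0 where k0: "W k0 = {0}" using W_bounds by blast
  have T: "csubspace ?T" by (rule csubspace_isum[OF bigrading_deligne_space])
  \<comment> \<open>This inclusion keeps the remainder in \<open>conj_F_sum r l\<close> when a
    vector of the target is subtracted.\<close>
  have TS: "?T \<subseteq> conj_F_sum r l"
    by (rule isum_least[OF csubspace_conj_F_sum]) (use deligne_space_sub_conj_F_sum in blast)
  have "v \<in> ?T" if "v \<in> conj_F_sum r l" "v \<in> W (l - int m)" for v m
    using that
  proof (induction "nat (l - int m - k0)" arbitrary: v m rule: less_induct)
    case less
    show ?case
    proof (cases "l - int m \<le> k0")
      case True
      then have "v = 0" using less.prems(2) W_monoD[of v "l - int m" k0] k0 by auto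
      then show ?thesis using csubspace_zero[OF T] by simp
    next
      case False
      obtain c where c: "cvconj c \<in> F (r - int m)" "v - c \<in> W (l - int m - 1)"
        using less.prems(1) unfolding conj_F_sum_def by blast
      have "c \<in> W (l - int m)" using W_of_diff[OF less.prems(2) c(2)] by simp
      then have "cvconj c \<in> isum deligne_space (\<lambda>a b. a \<ge> r - int m \<and> a + b \<le> l - int m)"
        using F_W_isum[OF c(1)] by (simp add: W_conj_iff)
      moreover have "isum deligne_space (\<lambda>a b. a \<ge> r - int m \<and> a + b \<le> l - int m)
          \<subseteq> {u. cvconj u \<in> sumset ?T (W (l - int m - 1))}"
      proof (rule isum_least[OF csubspace_cvconj_vimage[OF csubspace_sumset[OF T W_csubspace]]])
        fix a b x assume ab: "r - int m \<le> a \<and> a + b \<le> l - int m" and x: "x \<in> deligne_space a b"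
        obtain y where y: "y \<in> deligne_space b a" "cvconj x - y \<in> W (a + b - 1)" using conj_deligne_space_mod[OF x] .
        have "cvconj x \<in> sumset ?T (W (l - int m - 1))"
        proof (cases "a + b = l - int m")
          case True
          \<comment> \<open>In top weight \<open>b = l - m - a\<close>, and
            \<open>a \<ge> r - m\<close> gives \<open>b \<le> l - r\<close>.\<close>
          then have "y \<in> ?T" using y(1) ab by (intro isum_incl[of _ b a]) auto
          moreover have "cvconj x = y + (cvconj x - y)" by simp
          ultimately show ?thesis using y(2) True unfolding sumset_def by (metis (mono_tags, lifting) CollectI)
        next
          case False
          then have "cvconj x \<in> W (l - int m - 1)" using ab deligne_space_W[OF x] by (auto simp: W_conj_iff intro: W_monoD)
          then show ?thesis using csubspace_zero[OF T] unfolding sumset_def by force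
        qed
        then show "x \<in> {u. cvconj u \<in> sumset ?T (W (l - int m - 1))}" by simp
      qed
      ultimately have "c \<in> sumset ?T (W (l - int m - 1))" by auto
      then obtain t w where tw: "c = t + w" "t \<in> ?T" "w \<in> W (l - int m - 1)" by (auto simp: sumset_def)
      have "v - t \<in> ?T"
      proof (rule less.hyps[of "Suc m"])
        show "v - t \<in> conj_F_sum r l" using less.prems(1) tw(2) TS csubspace_diff[OF csubspace_conj_F_sum] by blast
        show "v - t \<in> W (l - int (Suc m))"
          using W_add[OF c(2) tw(3)] tw(1) by (simp add: algebra_simps)
      qed (use False in auto)
      then show ?thesis using csubspace_add[OF T _ tw(2), of "v - t"] by simp
    qed
  qed
  from this[of _ 0] show ?thesis by (auto simp: conj_F_sum_def)
qed

text \<open>Sharpens the congruence modulo \<open>W (p + q - 1)\<close>. The bound on the first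
  index holds because the difference lies in \<open>conj_F_sum p (p + q - 1)\<close>; the bound on
  the second comes from an approximant of \<open>x\<close> fitted to the component at hand.\<close>

lemma conj_deligne_space:
  assumes x: "x \<in> deligne_space p q"
  obtains y where "y \<in> deligne_space q p" "cvconj x - y \<in> isum deligne_space (\<lambda>r s. r < q \<and> s < p)"
proof -
  obtain y where y: "y \<in> deligne_space q p" and d: "cvconj x - y \<in> W (p + q - 1)" using conj_deligne_space_mod[OF x] .
  let ?d = "cvconj x - y"
  have "?d \<in> conj_F_sum p (p + q - 1)"
  proof -
    have "\<exists>c. cvconj c \<in> F (p - int n) \<and> ?d - c \<in> W (p + q - 1 - int n - 1)" for n
    proof -
      obtain c where c: "cvconj c \<in> F (p - int n)" "y - c \<in> W (q + p - int n - 2)"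
        using deligne_space_conj_F_sum'[OF y] unfolding conj_F_sum'_def by blast
      have "x \<in> F (p - int n)" using deligne_space_F[OF x] by (rule F_antimonoD) simp
      then show ?thesis
        using F_diff c W_minus_commute[OF c(2)]
        by (intro exI[of _ "cvconj x - c"]) (auto simp: cvconj_diff algebra_simps)
    qed
    with d show ?thesis unfolding conj_F_sum_def by blast
  qed
  then have 1: "bproj deligne_space r s ?d = 0" if "\<not> r < q" for r s
    using conj_F_sum_sub_isum that by (force simp: mem_isum_iff[OF bigrading_deligne_space])
  have 2: "bproj deligne_space r s ?d = 0" if "\<not> s < p" for r s
  proof (cases "r + s \<le> p + q - 1")
    case False
    with d show ?thesis by (simp add: W_eq_isum mem_isum_iff[OF bigrading_deligne_space])
  next
    case True
    \<comment> \<open>With this \<open>n\<close>, \<open>F (q - n)\<close> is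
      \<open>F (r + 1)\<close> and \<open>W (p + q - n - 2)\<close> is \<open>W (p + r - 1)\<close>;
      neither has a component at \<open>(r, s)\<close> when \<open>s \<ge> p\<close>.\<close>
    define n where "n = nat (q - 1 - r)"
    have n: "int n = q - 1 - r" using True that by (simp add: n_def)
    obtain c where c: "cvconj c \<in> F (q - int n)" "x - c \<in> W (p + q - int n - 2)"
      using deligne_space_conj_F_sum'[OF x] unfolding conj_F_sum'_def by blast
    have "y \<in> F (q - int n)" using deligne_space_F[OF y] by (rule F_antimonoD) simp
    then have "cvconj c - y \<in> F (q - int n)" using c F_diff by blast
    then have 3: "bproj deligne_space r s (cvconj c - y) = 0"
      using n by (simp add: F_eq_isum mem_isum_iff[OF bigrading_deligne_space])
    have "cvconj x - cvconj c \<in> W (p + q - int n - 2)"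
      using c(2) by (simp add: cvconj_diff[symmetric] W_conj_iff)
    then have "bproj deligne_space r s (cvconj x - cvconj c) = 0"
      using n that by (simp add: W_eq_isum mem_isum_iff[OF bigrading_deligne_space])
    with 3 show ?thesis by (simp add: bproj_diff[OF bigrading_deligne_space])
  qed
  have "?d \<in> isum deligne_space (\<lambda>r s. r < q \<and> s < p)"
    using 1 2 by (auto simp: mem_isum_iff[OF bigrading_deligne_space])
  with y that show thesis by blast
qed

lemma conj_deligne_space_isum:
  assumes "u \<in> isum deligne_space (\<lambda>r s. r < p \<and> s < q)"
  shows "cvconj u \<in> isum deligne_space (\<lambda>r s. r < q \<and> s < p)"
proof -
  let ?K = "isum deligne_space (\<lambda>r s. r < q \<and> s < p)"
  have K: "csubspace ?K" by (rule csubspace_isum[OF bigrading_deligne_space])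
  have "isum deligne_space (\<lambda>r s. r < p \<and> s < q) \<subseteq> {u. cvconj u \<in> ?K}"
  proof (rule isum_least[OF csubspace_cvconj_vimage[OF K]])
    fix a b v assume ab: "a < p \<and> b < q" and v: "v \<in> deligne_space a b"
    obtain y where y: "y \<in> deligne_space b a" "cvconj v - y \<in> isum deligne_space (\<lambda>r s. r < b \<and> s < a)"
      using conj_deligne_space[OF v] .
    have "y \<in> ?K" using y(1) ab by (intro isum_incl[of _ b a]) auto
    moreover have "cvconj v - y \<in> ?K"
      using y(2) by (rule subsetD[OF isum_mono, rotated]) (use ab in auto)
    ultimately show "v \<in> {u. cvconj u \<in> ?K}"
      using csubspace_add[OF K, of y "cvconj v - y"] by simp
  qed
  with assms show ?thesis by blast
qed

section \<open>Existence and uniqueness of the Deligne bigrading\<close>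

lemma is_deligne_bigrading_deligne_space: "is_deligne_bigrading F W deligne_space"
proof -
  have "sumset (cvconj ` deligne_space p q) (isum deligne_space (\<lambda>r s. r < q \<and> s < p)) =
        sumset (deligne_space q p) (isum deligne_space (\<lambda>r s. r < q \<and> s < p))" for p q
  proof -
    let ?K = "isum deligne_space (\<lambda>r s. r < q \<and> s < p)"
    have K: "csubspace ?K" by (rule csubspace_isum[OF bigrading_deligne_space])
    have "cvconj x + w \<in> sumset (deligne_space q p) ?K" if x: "x \<in> deligne_space p q" and w: "w \<in> ?K" for x w
    proof -
      obtain y where y: "y \<in> deligne_space q p" "cvconj x - y \<in> ?K" using conj_deligne_space[OF x] .
      then have "cvconj x + w = y + (cvconj x - y + w)" "cvconj x - y + w \<in> ?K"
        using csubspace_add[OF K] w by auto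
      with y show ?thesis unfolding sumset_def by blast
    qed
    moreover have "y + w \<in> sumset (cvconj ` deligne_space p q) ?K" if y: "y \<in> deligne_space q p" and w: "w \<in> ?K" for y w
    proof -
      obtain x where x: "x \<in> deligne_space p q" "cvconj y - x \<in> isum deligne_space (\<lambda>r s. r < p \<and> s < q)"
        using conj_deligne_space[OF y] .
      have "y - cvconj x \<in> ?K" using conj_deligne_space_isum[OF x(2)] by (simp add: cvconj_diff)
      then have "y + w = cvconj x + (y - cvconj x + w)" "y - cvconj x + w \<in> ?K"
        using csubspace_add[OF K] w by auto
      with x show ?thesis unfolding sumset_def by blast
    qed
    ultimately show ?thesis by (auto simp: sumset_def)
  qed
  then show ?thesis
    using bigrading_deligne_space F_eq_isum W_eq_isum unfolding is_deligne_bigrading_def bigrading_def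
    by (intro conjI) simp_all
qed

text \<open>An inclusion of pieces is enough by \<open>bigrading_le_imp_eq\<close>, and the
  conjugation relation for \<open>J\<close> provides the approximants in Deligne's formula.\<close>

lemma deligne_bigrading_unique:
  assumes J: "is_deligne_bigrading F W J"
  shows "J = deligne_space"
proof (rule bigrading_le_imp_eq[OF bigrading_deligne_space])
  show bJ: "bigrading J" using J unfolding is_deligne_bigrading_def bigrading_def by blast
  have FJ: "F p = isum J (\<lambda>a b. a \<ge> p)" and WJ: "W k = isum J (\<lambda>a b. a + b \<le> k)" for p k
    using J unfolding is_deligne_bigrading_def by blast+
  have cJ: "sumset (cvconj ` J p q) (isum J (\<lambda>r s. r < q \<and> s < p)) =
            sumset (J q p) (isum J (\<lambda>r s. r < q \<and> s < p))" for p q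
    using J unfolding is_deligne_bigrading_def by blast
  show "J p q \<subseteq> deligne_space p q" for p q
  proof
    fix x assume x: "x \<in> J p q"
    have xF: "x \<in> F p" unfolding FJ using x by (intro isum_incl[of _ p q]) auto
    have xW: "x \<in> W (p + q)" unfolding WJ using x by (intro isum_incl[of _ p q]) auto
    have "cvconj x \<in> sumset (cvconj ` J p q) (isum J (\<lambda>r s. r < q \<and> s < p))"
      unfolding sumset_def using x csubspace_zero[OF csubspace_isum[OF bJ]] by force
    then obtain y w where y: "y \<in> J q p" and w: "w \<in> isum J (\<lambda>r s. r < q \<and> s < p)" and cx: "cvconj x = y + w"
      unfolding cJ by (auto simp: sumset_def)
    have "\<exists>c. cvconj c \<in> F (q - int n) \<and> x - c \<in> W (p + q - int n - 2)" for n
    proof -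
      let ?K = "sumset (F (q - int n)) (W (p + q - int n - 2))"
      have K: "csubspace ?K" by (intro csubspace_sumset F_csubspace W_csubspace)
      have "isum J (\<lambda>r s. r < q \<and> s < p) \<subseteq> ?K"
      proof (rule isum_least[OF K])
        fix r s v assume rs: "r < q \<and> s < p" and v: "v \<in> J r s"
        show "v \<in> ?K"
        proof (cases "r \<ge> q - int n")
          case True
          then have "v \<in> F (q - int n)" unfolding FJ using v by (intro isum_incl[of _ r s]) auto
          then show ?thesis unfolding sumset_def using W_zero by force
        next
          case False
          \<comment> \<open>Here \<open>r \<le> q - n - 1\<close> and \<open>s \<le> p - 1\<close>,
            which accounts for the gap of two in the weight.\<close>
          then have "v \<in> W (p + q - int n - 2)" unfolding WJ using v rs by (intro isum_incl[of _ r s]) auto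
          then show ?thesis unfolding sumset_def using F_zero by force
        qed
      qed
      moreover have "y \<in> F (q - int n)" unfolding FJ using y by (intro isum_incl[of _ q p]) auto
      then have "y \<in> ?K" unfolding sumset_def using W_zero by force
      ultimately have "cvconj x \<in> ?K" unfolding cx using w csubspace_add[OF K] by blast
      then obtain f w where "f \<in> F (q - int n)" "w \<in> W (p + q - int n - 2)" "cvconj x = f + w"
        by (auto simp: sumset_def)
      moreover from this have "x - cvconj f = cvconj w"
        by (metis add_diff_cancel_left' cvconj_cvconj cvconj_diff)
      ultimately show ?thesis by (intro exI[of _ "cvconj f"]) (simp add: W_conj_iff)
    qed
    with xF xW show "x \<in> deligne_space p q" by (auto simp: deligne_space_def conj_F_sum'_def)
  qed
qed

lemma deligne_eq_deligne_space: "deligne F W = deligne_space"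
  unfolding deligne_def
  using is_deligne_bigrading_deligne_space deligne_bigrading_unique by (rule the_equality)

lemma bigrading_deligne: "bigrading (deligne F W)"
  unfolding deligne_eq_deligne_space by (rule bigrading_deligne_space)

lemma F_eq_isum_deligne: "F p = isum (deligne F W) (\<lambda>a b. a \<ge> p)"
  unfolding deligne_eq_deligne_space by (rule F_eq_isum)

lemma W_eq_isum_deligne: "W k = isum (deligne F W) (\<lambda>a b. a + b \<le> k)"
  unfolding deligne_eq_deligne_space by (rule W_eq_isum)

lemma deligne_F: "v \<in> deligne F W p q \<Longrightarrow> v \<in> F p"
  and deligne_W: "v \<in> deligne F W p q \<Longrightarrow> v \<in> W (p + q)"
  unfolding deligne_eq_deligne_space by (fact deligne_space_F deligne_space_W)+

lemma conj_deligne: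
  assumes "x \<in> deligne F W p q"
  obtains y where "y \<in> deligne F W q p" "cvconj x - y \<in> isum (deligne F W) (\<lambda>r s. r < q \<and> s < p)"
  using assms conj_deligne_space unfolding deligne_eq_deligne_space by blast

lemma Yop_deligne: "v \<in> deligne F W p q \<Longrightarrow> Yop F W *v v = of_int (p + q) *s v"
  using theI'[OF bigrading_weight_operator[OF bigrading_deligne]] unfolding Yop_def by blast

lemma bproj_Yop:
  "bproj (deligne F W) p q (Yop F W *v v) = of_int (p + q) *s bproj (deligne F W) p q v"
proof -
  note big = bigrading_deligne
  have "v \<in> {v. bproj (deligne F W) p q (Yop F W *v v) = of_int (p + q) *s bproj (deligne F W) p q v}"
    by (rule bigrading_all[OF big])
      (auto simp: csubspace_def bproj_add[OF big] bproj_scale[OF big] bproj_zero[OF big] vec.add vec.scale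
        Yop_deligne bproj_of_mem[OF big] vector_add_ldistrib mult.commute simp del: of_int_add)
  then show ?thesis by simp
qed

end

section \<open>Polarized mixed Hodge structures as opposed filtrations\<close>

lemma Mset_imp_mixed_hodge:
  assumes st: "standing W Q" and F: "F \<in> Mset W Q dF"
  shows "mixed_hodge W F"
proof
  fix k p v
  have W: "csubspace (W k)" "W k \<subseteq> W (k + 1)" "W k = cspan {v \<in> W k. rat_vec v}" for k
    using st by (auto simp: standing_def)
  show "csubspace (W k)" "W k \<subseteq> W (k + 1)" "\<exists>k0 k1. W k0 = {0} \<and> W k1 = UNIV"
    using W st by (auto simp: standing_def)
  \<comment> \<open>Conjugation fixes rational vectors, so a complex subspace spanned by them is
    stable.\<close>
  show conjW: "cvconj v \<in> W k" if "v \<in> W k" for v k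
  proof -
    have "v \<in> cspan {v \<in> W k. rat_vec v}"
      using that equalityD1[OF W(3)[of k]] by (rule rev_subsetD)
    then obtain T c where T: "T \<subseteq> {v \<in> W k. rat_vec v}" "v = (\<Sum>t\<in>T. c t *s t)"
      unfolding cspan_def by blast
    have "cvconj (sum f A) = (\<Sum>t\<in>A. cvconj (f t))" for f :: "'a vecC \<Rightarrow> 'a vecC" and A
      by (induction A rule: infinite_finite_induct) (auto simp: cvconj_add)
    moreover have "cvconj t = t" if "t \<in> T" for t
    proof -
      have "cnj z = z" if "z \<in> \<rat>" for z :: complex
        using that by (auto elim!: Rats_cases')
      then show ?thesis using that T(1) by (auto simp: rat_vec_def cvconj_def vec_eq_iff)
    qed
    ultimately have "cvconj v = (\<Sum>t\<in>T. cnj (c t) *s t)"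
      using T(2) by (simp add: cvconj_scale)
    then show ?thesis
      using T(1) by (auto intro!: csubspace_sum csubspace_scale W(1))
  qed
  show "csubspace (F p)" "F (p + 1) \<subseteq> F p" "\<exists>p0 p1. F p0 = UNIV \<and> F p1 = {0}"
    using F by (auto simp: Mset_def)
  have H1: "sumset (sumset (F p \<inter> W k) (W (k - 1)))
             (cvconj ` sumset (F (k - p + 1) \<inter> W k) (W (k - 1))) = W k"
    and H2: "sumset (F p \<inter> W k) (W (k - 1)) \<inter>
             cvconj ` sumset (F (k - p + 1) \<inter> W k) (W (k - 1)) = W (k - 1)"
    using F by (auto simp: Mset_def)
  show "\<exists>f g. f \<in> F p \<and> f \<in> W k \<and> cvconj g \<in> F (k - p + 1) \<and> g \<in> W k \<and> v - f - g \<in> W (k - 1)"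
    if v: "v \<in> W k"
  proof -
    obtain f w g u where "f \<in> F p" "f \<in> W k" "w \<in> W (k - 1)" "g \<in> F (k - p + 1)" "g \<in> W k" "u \<in> W (k - 1)"
      "v = f + w + cvconj (g + u)"
      using rev_subsetD[OF v equalityD2[OF H1]] by (auto simp: sumset_def)
    then show ?thesis
      using conjW csubspace_add[OF W(1), of w "k - 1" "cvconj u"]
      by (intro exI[of _ f] exI[of _ "cvconj g"]) (auto simp: cvconj_add algebra_simps)
  qed
  show "v \<in> W (k - 1)" if v: "v \<in> W k" and f: "f \<in> F p" "v - f \<in> W (k - 1)"
    and g: "cvconj g \<in> F (k - p + 1)" "v - g \<in> W (k - 1)" for f g
  proof -
    have sub: "W (k - 1) \<subseteq> W k" using W(2)[of "k - 1"] by simp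
    have "v - (v - f) \<in> W k" "v - (v - g) \<in> W k"
      using v f g sub csubspace_diff[OF W(1)] by blast+
    then have "f \<in> W k" "cvconj g \<in> W k" using conjW by simp_all
    moreover have "v = f + (v - f)" "cvconj v = cvconj g + cvconj (v - g)" by (auto simp: cvconj_diff)
    ultimately have "v \<in> sumset (F p \<inter> W k) (W (k - 1))"
      "cvconj v \<in> sumset (F (k - p + 1) \<inter> W k) (W (k - 1))"
      using f g conjW unfolding sumset_def by blast+
    then show ?thesis using H2 by (auto simp: in_cvconj_image_iff)
  qed
qed

section \<open>Derivatives of matrix-valued functions\<close>

lemma linear_matrix_mul_left: "linear (\<lambda>B. (A::('n::finite) matC) ** B)"
  by (rule linearI)
    (auto simp: matrix_matrix_mult_def vec_eq_iff scaleR_sum_right sum.distrib algebra_simps)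

lemma linear_matrix_mul_right: "linear (\<lambda>A. A ** (B::('n::finite) matC))"
  by (rule linearI)
    (auto simp: matrix_matrix_mult_def vec_eq_iff scaleR_sum_right sum.distrib algebra_simps)

lemma bounded_bilinear_matrix_mul:
  "bounded_bilinear ((**) :: ('n::finite) matC \<Rightarrow> 'n matC \<Rightarrow> 'n matC)"
  by (rule iffD1[OF bilinear_conv_bounded_bilinear])
    (simp add: bilinear_def linear_matrix_mul_left linear_matrix_mul_right)

lemma bounded_linear_matrix_vector: "bounded_linear (\<lambda>A::('n::finite) matC. A *v v)"
  by (rule iffD1[OF linear_conv_bounded_linear], rule linearI)
    (auto simp: matrix_vector_mult_def vec_eq_iff scaleR_sum_right sum.distrib algebra_simps)

lemma bounded_linear_cmconj: "bounded_linear (cmconj :: ('n::finite) matC \<Rightarrow> 'n matC)"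
  by (rule iffD1[OF linear_conv_bounded_linear], rule linearI)
    (auto simp: cmconj_def vec_eq_iff)

lemma bounded_linear_mscale: "bounded_linear (\<lambda>z. mscale z (A::('n::finite) matC))"
  by (rule iffD1[OF linear_conv_bounded_linear], rule linearI)
    (auto simp: mscale_def vec_eq_iff algebra_simps)

lemma csubspace_imp_subspace:
  fixes S :: "('n::finite) vecC set"
  assumes "csubspace S" shows "subspace S"
proof -
  have "c *\<^sub>R x = complex_of_real c *s x" for c and x :: "'n vecC"
    by (simp add: vec_eq_iff scaleR_conv_of_real[where 'a = complex])
  then show ?thesis using assms by (auto simp: csubspace_def subspace_def)
qed

text \<open>The difference quotients lie in \<open>S\<close>, and a finite-dimensional subspace is
  closed. In this way constraints on a curve pass to its derivative.\<close>

lemma vector_derivative_in_csubspace: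
  fixes f :: "real \<Rightarrow> ('n::finite) vecC"
  assumes S: "csubspace S" and f: "\<And>t. t > a \<Longrightarrow> f t \<in> S"
    and y: "y > a" and f': "(f has_vector_derivative f') (at y)"
  shows "f' \<in> S"
proof -
  have sub: "subspace S" using S by (rule csubspace_imp_subspace)
  have "((\<lambda>t. (f t - f y) /\<^sub>R (t - y)) \<longlongrightarrow> f') (at y)"
  proof -
    have "((\<lambda>t. norm (f t - f y - (t - y) *\<^sub>R f') / norm (t - y)) \<longlongrightarrow> 0) (at y)"
      using f' by (simp add: has_vector_derivative_def has_derivative_iff_norm)
    moreover have "eventually (\<lambda>t. norm (f t - f y - (t - y) *\<^sub>R f') / norm (t - y) =
        norm ((f t - f y) /\<^sub>R (t - y) - f')) (at y)"
    proof -
      have "norm (f t - f y - (t - y) *\<^sub>R f') / norm (t - y) = norm ((f t - f y) /\<^sub>R (t - y) - f')"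
        if "t \<noteq> y" for t
      proof -
        have "(f t - f y) /\<^sub>R (t - y) - f' = (f t - f y - (t - y) *\<^sub>R f') /\<^sub>R (t - y)"
          using that by (simp add: scaleR_right_diff_distrib)
        then show ?thesis by (simp add: divide_inverse_commute)
      qed
      then show ?thesis by (rule eventually_mono[OF eventually_neq_at_within])
    qed
    ultimately have "((\<lambda>t. norm ((f t - f y) /\<^sub>R (t - y) - f')) \<longlongrightarrow> 0) (at y)"
      by (rule Lim_transform_eventually)
    then show ?thesis by (rule LIM_zero_cancel[OF tendsto_norm_zero_cancel])
  qed
  moreover have "eventually (\<lambda>t. (f t - f y) /\<^sub>R (t - y) \<in> S) (at y)"
  proof -
    have "eventually (\<lambda>t. t \<in> {a<..}) (at y)"
      using y by (intro eventually_at_in_open') auto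
    then show ?thesis
      by eventually_elim (use f y sub in \<open>auto intro!: subspace_scale subspace_diff\<close>)
  qed
  ultimately show ?thesis
    using closed_subspace[OF sub] by (intro Lim_in_closed_set[of S _ "at y"]) auto
qed

section \<open>Exponential of a nilpotent endomorphism\<close>

lemma mpow_commute: "mpow N k ** N = N ** mpow N k"
  by (induction k) (simp_all add: matrix_mul_assoc[symmetric])

lemma mpow_add: "mpow N (j + k) = mpow N j ** mpow N k"
  by (induction j) (simp_all add: matrix_mul_assoc)

text \<open>Ensures that stopping \<open>mexp_nil\<close> before the exponent
  \<open>CARD('n)\<close> cuts off nothing. The images of the powers shrink strictly until they are
  zero, so \<open>CARD('n)\<close> steps suffice.\<close>

lemma nilpotent_mpow_card:
  fixes N :: "('n::finite) matC"
  assumes "nilpotent_mat N"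
  shows "mpow N CARD('n) = 0"
proof -
  define R where "R j = range (\<lambda>v. mpow N j *v v)" for j
  have R0: "R 0 = UNIV" by (auto simp: R_def)
  have RSuc: "R (Suc j) = (*v) N ` R j" for j
    by (auto simp: R_def image_image matrix_vector_mul_assoc)
  have sub: "vec.subspace (R j)" for j
    unfolding R_def by (rule vec.subspace_image[OF vec.subspace_UNIV])
  have dec: "R (Suc j) \<subseteq> R j" for j
    unfolding R_def by (auto simp: mpow_commute[symmetric] simp flip: matrix_vector_mul_assoc)
  obtain K where K: "mpow N K = 0" using assms by (auto simp: nilpotent_mat_def)
  have strict: "R (Suc j) \<subset> R j" if "R j \<noteq> {0}" for j
  proof (rule ccontr)
    assume "\<not> R (Suc j) \<subset> R j"
    then have eq: "R (Suc j) = R j" using dec by blast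
    have "R (i + j) = R j" for i
      by (induction i) (use RSuc eq in auto)
    then have "R j = R (K + j)" by simp
    also have "\<dots> = {0}" by (auto simp: R_def mpow_add K)
    finally show False using that by simp
  qed
  have "R j = {0} \<or> vec.dim (R j) + j \<le> CARD('n)" for j
  proof (induction j)
    case 0
    then show ?case by (simp add: R0 card_cart_basis)
  next
    case (Suc j)
    show ?case
    proof (cases "R j = {0}")
      case True
      then show ?thesis using RSuc by auto
    next
      case False
      then have "vec.dim (R (Suc j)) < vec.dim (R j)"
        using strict sub by (intro vec.dim_psubset) (simp add: vec.span_eq_iff[THEN iffD2])
      then show ?thesis using Suc False by auto
    qed
  qed
  from this[of "CARD('n)"] have "R (CARD('n)) \<subseteq> {0}"
    using vec.dim_eq_0[of "R (CARD('n))"] by auto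
  then show ?thesis by (auto simp: R_def matrix_eq)
qed

lemma mexp_nil_zero: "mexp_nil 0 (N::('n::finite) matC) = mat 1"
proof -
  have "mexp_nil 0 N = (\<Sum>k\<in>{..<CARD('n)}. if k = 0 then mat 1 else 0)"
    unfolding mexp_nil_def by (rule sum.cong) (auto simp: mscale_def vec_eq_iff)
  then show ?thesis by simp
qed

lemma mscale_mul_left: "mscale c A ** B = mscale c (A ** B)"
  and mscale_mul_right: "A ** mscale c B = mscale c (A ** B)"
  and mscale_mscale: "mscale c (mscale d A) = mscale (c * d) A"
  and mscale_add: "mscale c (A + B) = mscale c A + mscale c B"
  and mscale_zero [simp]: "mscale c 0 = 0" "mscale 0 A = 0"
  and mscale_one: "mscale 1 A = A"
  by (auto simp: mscale_def matrix_matrix_mult_def vec_eq_iff sum_distrib_left algebra_simps)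

lemma mscale_sum: "mscale c (sum f S) = (\<Sum>i\<in>S. mscale c (f i))"
  by (induction S rule: infinite_finite_induct) (auto simp: mscale_add)

lemma matrix_mul_sum_right: "(A::('n::finite) matC) ** sum f S = (\<Sum>i\<in>S. A ** f i)"
  by (rule linear_sum[OF linear_matrix_mul_left])

lemma matrix_mul_sum_left: "sum f S ** (A::('n::finite) matC) = (\<Sum>i\<in>S. f i ** A)"
  by (rule linear_sum[OF linear_matrix_mul_right])

lemma mexp_nil_commute: "mexp_nil z N ** N = N ** mexp_nil z N"
  by (simp add: mexp_nil_def matrix_mul_sum_left matrix_mul_sum_right mscale_mul_left mscale_mul_right mpow_commute)

lemma has_vector_derivative_mexp_nil:
  fixes N :: "('n::finite) matC"
  assumes nil: "nilpotent_mat N"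
  shows "((\<lambda>t. mexp_nil (c * of_real t) N) has_vector_derivative mscale c (N ** mexp_nil (c * of_real t) N)) (at t)"
proof -
  define d where "d k = (if k = 0 then 0 else c * ((c * of_real t) ^ (k - 1) / fact (k - 1)))" for k :: nat
  have "((\<lambda>z. (c * z) ^ k / of_nat (fact k)) has_field_derivative d k) (at (of_real t))" for k
  proof (cases k)
    case (Suc j)
    have "((\<lambda>z. (c * z) ^ k / of_nat (fact k)) has_field_derivative
        (1 + of_nat j) * (c * (c * of_real t) ^ j) / of_nat (fact k)) (at (of_real t))"
      unfolding Suc by (intro DERIV_cdivide DERIV_power_Suc) (auto intro!: derivative_eq_intros)
    moreover have "(1 + of_nat j) * x / of_nat (fact k) = x / fact j" for x :: complex
    proof -
      have "of_nat (fact k) = (1 + of_nat j) * (fact j :: complex)" by (simp add: Suc algebra_simps)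
      moreover have "1 + of_nat j \<noteq> (0 :: complex)" by (metis of_nat_Suc of_nat_neq_0)
      ultimately show ?thesis by simp
    qed
    ultimately show ?thesis by (simp add: d_def Suc)
  qed (simp add: d_def)
  then have "((\<lambda>t. (c * of_real t) ^ k / of_nat (fact k)) has_vector_derivative d k) (at t)" for k
    by (rule has_vector_derivative_real_field)
  then have deriv: "((\<lambda>t. mexp_nil (c * of_real t) N) has_vector_derivative (\<Sum>k<CARD('n). mscale (d k) (mpow N k))) (at t)"
    unfolding mexp_nil_def
    by (intro has_vector_derivative_sum bounded_linear.has_vector_derivative[OF bounded_linear_mscale])
  obtain m where m: "CARD('n) = Suc m" using gr0_implies_Suc[OF zero_less_card_finite] by blast
  have "(\<Sum>k<CARD('n). mscale (d k) (mpow N k)) = (\<Sum>k<m. mscale (d (Suc k)) (mpow N (Suc k)))"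
    unfolding m by (subst sum.lessThan_Suc_shift) (simp add: d_def)
  \<comment> \<open>The added term carries \<open>N\<close> to the power \<open>CARD('n)\<close> and
    is zero; with it the sum again has the full range of the exponential.\<close>
  also have "\<dots> = (\<Sum>k<Suc m. mscale (d (Suc k)) (mpow N (Suc k)))"
    using nilpotent_mpow_card[OF nil] m by simp
  also have "\<dots> = mscale c (N ** mexp_nil (c * of_real t) N)"
    by (simp add: mexp_nil_def m matrix_mul_sum_right mscale_sum mscale_mul_right mscale_mscale d_def
        del: sum.lessThan_Suc)
  finally show ?thesis using deriv by simp
qed

text \<open>The product has derivative zero because \<open>N\<close> commutes with its exponential,
  so it keeps its value at \<open>0\<close>; no double sum is rearranged.\<close>

lemma mexp_nil_inverse:
  fixes N :: "('n::finite) matC"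
  assumes nil: "nilpotent_mat N"
  shows "mexp_nil (- c * of_real t) N ** mexp_nil (c * of_real t) N = mat 1"
proof -
  let ?f = "\<lambda>t. mexp_nil (- c * of_real t) N ** mexp_nil (c * of_real t) N"
  have "(?f has_vector_derivative
      mexp_nil (- c * of_real t) N ** mscale c (N ** mexp_nil (c * of_real t) N) +
      mscale (- c) (N ** mexp_nil (- c * of_real t) N) ** mexp_nil (c * of_real t) N) (at t)" for t
    by (rule bounded_bilinear.has_vector_derivative[OF bounded_bilinear_matrix_mul
          has_vector_derivative_mexp_nil[OF nil] has_vector_derivative_mexp_nil[OF nil]])
  moreover have "mexp_nil (- c * of_real t) N ** mscale c (N ** mexp_nil (c * of_real t) N) +
      mscale (- c) (N ** mexp_nil (- c * of_real t) N) ** mexp_nil (c * of_real t) N = 0" for t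
    unfolding mscale_mul_left mscale_mul_right matrix_mul_assoc mexp_nil_commute
    by (simp add: mscale_def vec_eq_iff)
  ultimately have "(?f has_vector_derivative 0) (at t within UNIV)" for t by simp
  then obtain C where C: "\<And>t. ?f t = C"
    using has_vector_derivative_zero_constant[of UNIV ?f] by auto
  have "?f t = ?f 0" using C by metis
  then show ?thesis by (simp add: mexp_nil_zero)
qed

section \<open>Differentiability of the inverse matrix\<close>

lemma matrix_inv_mul:
  assumes "invertible (A::('n::finite) matC)"
  shows "A ** matrix_inv A = mat 1" "matrix_inv A ** A = mat 1"
  using someI_ex[OF assms[unfolded invertible_def]] unfolding matrix_inv_def by blast+

lemma differentiable_det:
  fixes A :: "real \<Rightarrow> ('n::finite) matC"
  assumes "\<And>i j. (\<lambda>t. A t $ i $ j) differentiable (at y)"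
  shows "(\<lambda>t. det (A t)) differentiable (at y)"
proof -
  have "(\<lambda>t. \<Prod>i\<in>(UNIV::'n set). A t $ i $ p i) differentiable (at y)" for p
  proof -
    have "\<forall>i. \<exists>D. ((\<lambda>t. A t $ i $ p i) has_derivative D) (at y)"
      using assms by (simp add: differentiable_def)
    then obtain D where "\<And>i. ((\<lambda>t. A t $ i $ p i) has_derivative D i) (at y)" by metis
    then show ?thesis
      unfolding differentiable_def
      using has_derivative_prod[of UNIV "\<lambda>i t. A t $ i $ p i" D y UNIV] by blast
  qed
  then show ?thesis unfolding det_def
    by (intro differentiable_sum differentiable_mult differentiable_const) auto
qed

text \<open>Cramer's rule writes the entries of the inverse as quotients of differentiable
  determinants. Existence is enough: the derivative of \<open>k\<close> is later computed from the
  product \<open>h t ** k t\<close>.\<close>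

lemma matrix_inv_has_vector_derivative:
  fixes h :: "real \<Rightarrow> ('n::finite) matC"
  assumes h: "(h has_vector_derivative h') (at y)" and inv: "\<And>t. t > a \<Longrightarrow> invertible (h t)" and y: "y > a"
  shows "\<exists>D. ((\<lambda>t. matrix_inv (h t)) has_vector_derivative D) (at y)"
proof -
  define g where "g i j t = det (\<chi> r c. if c = i then axis j 1 $ r else h t $ r $ c) / det (h t)" for i j t
  have entry: "(\<lambda>t. h t $ i $ j) differentiable (at y)" for i j
    using bounded_linear.has_vector_derivative[OF bounded_linear_vec_nth
      bounded_linear.has_vector_derivative[OF bounded_linear_vec_nth h]]
    by (auto simp: has_vector_derivative_def differentiable_def)
  have det0: "det (h t) \<noteq> 0" if "t > a" for t using inv[OF that] by (simp add: invertible_det_nz)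
  have "g i j differentiable (at y)" for i j
  proof -
    have "(\<lambda>t. if c = i then axis j 1 $ r else h t $ r $ c) differentiable (at y)" for r c
      by (cases "c = i") (simp_all add: entry)
    then show ?thesis
      unfolding g_def using det0[OF y] entry by (intro differentiable_divide differentiable_det) auto
  qed
  then have "\<forall>i j. \<exists>D. (g i j has_vector_derivative D) (at y)"
    using vector_derivative_works by blast
  then obtain D where D: "\<And>i j. (g i j has_vector_derivative D i j) (at y)" by metis
  let ?E = "\<lambda>i j. (\<chi> r c. if r = i \<and> c = j then 1 else 0) :: 'n matC"
  have der: "((\<lambda>t. \<Sum>i\<in>UNIV. \<Sum>j\<in>UNIV. mscale (g i j t) (?E i j)) has_vector_derivative
      (\<Sum>i\<in>UNIV. \<Sum>j\<in>UNIV. mscale (D i j) (?E i j))) (at y)"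
    by (intro has_vector_derivative_sum bounded_linear.has_vector_derivative[OF bounded_linear_mscale] D)
  have eq: "(\<Sum>i\<in>UNIV. \<Sum>j\<in>UNIV. mscale (g i j t) (?E i j)) = matrix_inv (h t)" if t: "t \<in> {a<..}" for t
  proof -
    have "(\<Sum>i\<in>UNIV. \<Sum>j\<in>UNIV. mscale (g i j t) (?E i j)) $ r $ c = g r c t" for r c
    proof -
      have "(\<Sum>i\<in>UNIV. \<Sum>j\<in>UNIV. mscale (g i j t) (?E i j)) $ r $ c =
          (\<Sum>i\<in>UNIV. \<Sum>j\<in>UNIV. if j = c then if i = r then g i j t else 0 else 0)"
        unfolding sum_component mscale_def by (intro sum.cong refl) auto
      then show ?thesis by simp
    qed
    moreover have "matrix_inv (h t) $ r $ c = g r c t" for r c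
    proof -
      have "h t *v (matrix_inv (h t) *v axis c 1) = axis c 1"
        using matrix_inv_mul[OF inv] t by (simp add: matrix_vector_mul_assoc)
      then have "matrix_inv (h t) *v axis c 1 = (\<chi> i. g i c t)"
        unfolding g_def using cramer[OF det0] t by auto
      moreover have "matrix_inv (h t) $ r $ c = (matrix_inv (h t) *v axis c 1) $ r"
        by (simp add: matrix_vector_mult_def axis_def if_distrib cong: if_cong)
      ultimately show ?thesis by simp
    qed
    ultimately show ?thesis by (simp add: vec_eq_iff)
  qed
  show ?thesis
    by (rule exI, rule has_vector_derivative_transform_within_open[OF der open_greaterThan[of a]])
      (use y eq in auto)
qed

text \<open>The inverse exponential moves the varying subspace to the fixed \<open>S\<close>, where
  the derivative stays; multiplying back produces the term with \<open>N\<close>.\<close>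

lemma nilpotent_orbit_frame_derivative:
  fixes N :: "('n::finite) matC"
  assumes nil: "nilpotent_mat N" and S: "csubspace S"
    and h: "(h has_vector_derivative h') (at y)" and y: "y > a"
    and mem: "\<And>t. t > a \<Longrightarrow> h t *v v \<in> mimg (mexp_nil (\<i> * of_real t) N) S"
  shows "(h' - mscale \<i> (N ** h y)) *v v \<in> mimg (mexp_nil (\<i> * of_real y) N) S"
proof -
  let ?E = "\<lambda>t. mexp_nil (\<i> * of_real t) N" and ?E' = "\<lambda>t. mexp_nil (- \<i> * of_real t) N"
  have inv: "?E' t ** ?E t = mat 1" "?E t ** ?E' t = mat 1" for t
    using mexp_nil_inverse[OF nil, of \<i> t] mexp_nil_inverse[OF nil, of "- \<i>" t] by auto
  have "((\<lambda>t. ?E' t ** h t) has_vector_derivative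
      (?E' y ** h' + mscale (- \<i>) (N ** ?E' y) ** h y)) (at y)"
    by (rule bounded_bilinear.has_vector_derivative[OF bounded_bilinear_matrix_mul
          has_vector_derivative_mexp_nil[OF nil] h])
  then have der: "((\<lambda>t. (?E' t ** h t) *v v) has_vector_derivative
      (?E' y ** h' + mscale (- \<i>) (N ** ?E' y) ** h y) *v v) (at y)"
    by (rule bounded_linear.has_vector_derivative[OF bounded_linear_matrix_vector])
  have "(?E' t ** h t) *v v \<in> S" if t: "t > a" for t
  proof -
    obtain w where "h t *v v = ?E t *v w" "w \<in> S" using mem[OF t] by (auto simp: mimg_def)
    then show ?thesis using inv(1)[of t] by (metis matrix_vector_mul_assoc matrix_vector_mul_lid)
  qed
  from vector_derivative_in_csubspace[OF S this y der]
  have *: "(?E' y ** h' + mscale (- \<i>) (N ** ?E' y) ** h y) *v v \<in> S" .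
  have "?E y ** (?E' y ** h' + mscale (- \<i>) (N ** ?E' y) ** h y) = h' - mscale \<i> (N ** h y)"
  proof -
    have "?E y ** (mscale (- \<i>) (N ** ?E' y) ** h y) = mscale (- \<i>) ((?E y ** ?E' y) ** (N ** h y))"
      by (simp add: mscale_mul_left mscale_mul_right mexp_nil_commute[symmetric] matrix_mul_assoc)
    also have "\<dots> = - mscale \<i> (N ** h y)" unfolding inv(2) by (simp add: mscale_def vec_eq_iff)
    finally have "?E y ** (mscale (- \<i>) (N ** ?E' y) ** h y) = - mscale \<i> (N ** h y)" .
    moreover have "?E y ** (?E' y ** h') = h'" by (simp only: matrix_mul_assoc inv(2) matrix_mul_lid)
    ultimately show ?thesis by (simp add: matrix_add_ldistrib)
  qed
  then have "(h' - mscale \<i> (N ** h y)) *v v =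
      ?E y *v ((?E' y ** h' + mscale (- \<i>) (N ** ?E' y) ** h y) *v v)"
    by (metis matrix_vector_mul_assoc)
  with * show ?thesis unfolding mimg_def by blast
qed

section \<open>Endomorphisms and bigradings\<close>

text \<open>Support of an endomorphism in the bidegrees satisfying \<open>R\<close>, tested on the
  pieces, so that the matrix need not be split into homogeneous components.\<close>

definition shifts ::
    "(int \<Rightarrow> int \<Rightarrow> ('n::finite) vecC set) \<Rightarrow> (int \<Rightarrow> int \<Rightarrow> bool) \<Rightarrow> 'n matC \<Rightarrow> bool" where
  "shifts I R X \<longleftrightarrow> (\<forall>p q. \<forall>v\<in>I p q. X *v v \<in> isum I (\<lambda>a b. R (a - p) (b - q)))"

lemma shiftsD: "shifts I R X \<Longrightarrow> v \<in> I p q \<Longrightarrow> X *v v \<in> isum I (\<lambda>a b. R (a - p) (b - q))"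
  by (auto simp: shifts_def)

lemma shifts_mono:
  assumes "shifts I R X" "\<And>r s. R r s \<Longrightarrow> R' r s"
  shows "shifts I R' X"
proof -
  have "isum I (\<lambda>a b. R (a - p) (b - q)) \<subseteq> isum I (\<lambda>a b. R' (a - p) (b - q))" for p q
    by (rule isum_mono) (rule assms(2))
  then show ?thesis using assms(1) unfolding shifts_def by blast
qed

context
  fixes I :: "int \<Rightarrow> int \<Rightarrow> ('n::finite) vecC set"
  assumes big: "bigrading I"
begin

lemma shifts_zero: "shifts I R 0"
  by (simp add: shifts_def csubspace_zero[OF csubspace_isum[OF big]])

lemma shifts_add: "shifts I R X \<Longrightarrow> shifts I R Y \<Longrightarrow> shifts I R (X + Y)"
  by (simp add: shifts_def matrix_vector_mult_add_rdistrib csubspace_add[OF csubspace_isum[OF big]])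

lemma shifts_diff: "shifts I R X \<Longrightarrow> shifts I R Y \<Longrightarrow> shifts I R (X - Y)"
  by (simp add: shifts_def matrix_vector_mult_diff_rdistrib csubspace_diff[OF csubspace_isum[OF big]])

lemma shifts_mscale: "shifts I R X \<Longrightarrow> shifts I R (mscale c X)"
  by (simp add: shifts_def mscale_vector csubspace_scale[OF csubspace_isum[OF big]])

lemma shifts_sum: "(\<And>i. i \<in> S \<Longrightarrow> shifts I R (f i)) \<Longrightarrow> shifts I R (sum f S)"
  by (induction S rule: infinite_finite_induct) (auto simp: shifts_zero shifts_add)

lemma shifts_mul:
  assumes X: "shifts I R1 X" and Y: "shifts I R2 Y"
    and R: "\<And>r s r' s'. R1 r s \<Longrightarrow> R2 r' s' \<Longrightarrow> R (r + r') (s + s')"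
  shows "shifts I R (X ** Y)"
  unfolding shifts_def
proof (intro allI ballI)
  fix p q v assume v: "v \<in> I p q"
  let ?K = "isum I (\<lambda>a b. R (a - p) (b - q))"
  have K: "csubspace {u. X *v u \<in> ?K}"
    using csubspace_isum[OF big] by (auto simp: csubspace_def vec.add vec.scale)
  have "isum I (\<lambda>a b. R2 (a - p) (b - q)) \<subseteq> {u. X *v u \<in> ?K}"
  proof (rule isum_least[OF K])
    fix a b u assume ab: "R2 (a - p) (b - q)" and u: "u \<in> I a b"
    have "isum I (\<lambda>c d. R1 (c - a) (d - b)) \<subseteq> ?K"
    proof (rule isum_mono)
      fix c d assume "R1 (c - a) (d - b)"
      from R[OF this ab] show "R (c - p) (d - q)" by simp
    qed
    then show "u \<in> {u. X *v u \<in> ?K}" using shiftsD[OF X u] by blast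
  qed
  then show "X ** Y *v v \<in> ?K"
    using shiftsD[OF Y v] by (auto simp flip: matrix_vector_mul_assoc)
qed

text \<open>Conjugation exchanges \<open>I p q\<close> and \<open>I q p\<close> exactly, without
  lower terms; this is where splitting over the reals is used.\<close>

lemma shifts_cmconj:
  assumes conjI: "\<And>p q. cvconj ` I p q = I q p" and X: "shifts I R X"
  shows "shifts I (\<lambda>r s. R s r) (cmconj X)"
  unfolding shifts_def
proof (intro allI ballI)
  fix p q v assume v: "v \<in> I p q"
  let ?K = "isum I (\<lambda>a b. R (b - q) (a - p))"
  have K: "csubspace {u. cvconj u \<in> ?K}" by (rule csubspace_cvconj_vimage[OF csubspace_isum[OF big]])
  have "isum I (\<lambda>a b. R (a - q) (b - p)) \<subseteq> {u. cvconj u \<in> ?K}"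
  proof (rule isum_least[OF K])
    fix a b u assume "R (a - q) (b - p)" "u \<in> I a b"
    then show "u \<in> {u. cvconj u \<in> ?K}" using conjI[of a b] by (auto intro!: isum_incl[of _ b a])
  qed
  moreover have "cvconj v \<in> I q p" using v conjI[of p q] by blast
  ultimately have "cvconj (X *v cvconj v) \<in> ?K" using shiftsD[OF X] by blast
  then show "cmconj X *v v \<in> ?K" by (simp add: cmconj_vector)
qed

text \<open>Stands in for uniqueness of the homogeneous decomposition: every component of an image
  is excluded by one of the two conditions.\<close>

lemma shifts_disjoint:
  assumes "shifts I R X" "shifts I R' X" "\<And>r s. \<not> (R r s \<and> R' r s)"
  shows "X = 0"
proof -
  have "v \<in> {v. X *v v = 0}" for v
  proof (rule bigrading_all[OF big])
    show "csubspace {v. X *v v = 0}" by (auto simp: csubspace_def vec.add vec.scale)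
    fix p q v assume v: "v \<in> I p q"
    have "bproj I a b (X *v v) = 0" for a b
      using shiftsD[OF assms(1) v] shiftsD[OF assms(2) v] assms(3)[of "a - p" "b - q"]
      by (auto simp: mem_isum_iff[OF big])
    then show "v \<in> {v. X *v v = 0}" using bproj_all_zero[OF big] by simp
  qed
  then show ?thesis by (simp add: matrix_eq)
qed

end

section \<open>The Lie algebra \<open>gC\<close> and the operator \<open>L\<close>\<close>

lemma bil_add_left: "bil B (u + v) w = bil B u w + bil B v w"
  and bil_add_right: "bil B w (u + v) = bil B w u + bil B w v"
  and bil_scale_left: "bil B (c *s u) w = c * bil B u w"
  and bil_scale_right: "bil B w (c *s u) = c * bil B w u"
  by (simp_all add: bil_def matrix_vector_right_distrib vec.scale sum.distrib sum_distrib_left algebra_simps)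

lemma gC_W: "X \<in> gC W Q \<Longrightarrow> v \<in> W k \<Longrightarrow> X *v v \<in> W k"
  by (auto simp: gC_def mimg_def image_subset_iff)

context
  fixes W :: "int \<Rightarrow> ('n::finite) vecC set" and Q :: "int \<Rightarrow> 'n matC"
  assumes W: "\<And>k. csubspace (W k)"
begin

lemma gC_add: "X \<in> gC W Q \<Longrightarrow> Y \<in> gC W Q \<Longrightarrow> X + Y \<in> gC W Q"
proof -
  assume X: "X \<in> gC W Q" and Y: "Y \<in> gC W Q"
  have "bil (Q k) ((X + Y) *v u) v + bil (Q k) u ((X + Y) *v v) = 0" if "u \<in> W k" "v \<in> W k" for k u v
  proof -
    have "bil (Q k) (X *v u) v + bil (Q k) u (X *v v) = 0" "bil (Q k) (Y *v u) v + bil (Q k) u (Y *v v) = 0"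
      using X Y that by (auto simp: gC_def)
    then have "(bil (Q k) (X *v u) v + bil (Q k) u (X *v v)) + (bil (Q k) (Y *v u) v + bil (Q k) u (Y *v v)) = 0"
      by simp
    then show ?thesis
      by (simp only: matrix_vector_mult_add_rdistrib bil_add_left bil_add_right add_ac)
  qed
  then show ?thesis
    using X Y csubspace_add[OF W] by (auto simp: gC_def mimg_def matrix_vector_mult_add_rdistrib image_subset_iff)
qed

lemma gC_mscale: "X \<in> gC W Q \<Longrightarrow> mscale c X \<in> gC W Q"
  using csubspace_scale[OF W]
  by (auto simp: gC_def mimg_def mscale_vector image_subset_iff bil_scale_left bil_scale_right
      simp flip: distrib_left)

lemma gC_zero: "0 \<in> gC W Q"
  using csubspace_zero[OF W] by (auto simp: gC_def mimg_def bil_def)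

lemma gC_sum: "(\<And>i. i \<in> S \<Longrightarrow> f i \<in> gC W Q) \<Longrightarrow> sum f S \<in> gC W Q"
  by (induction S rule: infinite_finite_induct) (auto simp: gC_zero gC_add)

lemma gsum_gC: "X \<in> gsum W Q F R \<Longrightarrow> X \<in> gC W Q"
  by (auto simp: gsum_def grs_def intro!: gC_sum)

lemma gsum_mscale:
  assumes I: "\<And>p q. csubspace (deligne F W p q)" and X: "X \<in> gsum W Q F R"
  shows "mscale c X \<in> gsum W Q F R"
proof -
  obtain S x where S: "X = sum x S" "finite S" "S \<subseteq> {(r, s). R r s}" "\<forall>(r, s)\<in>S. x (r, s) \<in> grs W Q F r s"
    using X by (auto simp: gsum_def)
  have "mscale c (x (r, s)) \<in> grs W Q F r s" if "(r, s) \<in> S" for r s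
    using S(4) that csubspace_scale[OF I] gC_mscale
    by (fastforce simp: grs_def mimg_def mscale_vector image_subset_iff)
  with S show ?thesis
    by (auto simp: gsum_def mscale_sum intro!: exI[of _ S] exI[of _ "\<lambda>i. mscale c (x i)"])
qed

lemma gsum_shifts:
  assumes big: "bigrading (deligne F W)" and X: "X \<in> gsum W Q F R"
  shows "shifts (deligne F W) R X"
proof -
  obtain S x where S: "X = sum x S" "S \<subseteq> {(r, s). R r s}" "\<forall>(r, s)\<in>S. x (r, s) \<in> grs W Q F r s"
    using X by (auto simp: gsum_def)
  have "shifts (deligne F W) R (x i)" if "i \<in> S" for i
  proof -
    obtain r s where i: "i = (r, s)" by fastforce
    with S that have "R r s" "x i \<in> grs W Q F r s" by auto
    then show ?thesis
      unfolding shifts_def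
      by (auto simp: grs_def mimg_def image_subset_iff intro!: isum_incl[of _ "_ + r" "_ + s"])
  qed
  then show ?thesis unfolding S(1) by (rule shifts_sum[OF big])
qed

text \<open>Makes the definite description in \<open>Lop\<close> usable. The first index separates
  \<open>A + B\<close> from \<open>C + D\<close>, the second then separates \<open>A\<close> from
  \<open>B\<close>; \<open>C\<close> and \<open>D\<close> are compared only through their sum, since
  \<open>L\<close> acts on both by the same scalar.\<close>

lemma Lop_eqI:
  assumes big: "bigrading (deligne F W)"
    and A: "A \<in> eta_plus W Q F" and B: "B \<in> eta_zero W Q F"
    and C: "C \<in> eta_minus W Q F" and D: "D \<in> Lambda_rs W Q F" and X: "X = A + B + C + D"
  shows "Lop W Q F X = mscale \<i> A - mscale \<i> (C + D)"
  unfolding Lop_def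
proof (rule the_equality)
  show "\<exists>A' B' C' D'. A' \<in> eta_plus W Q F \<and> B' \<in> eta_zero W Q F \<and> C' \<in> eta_minus W Q F \<and>
      D' \<in> Lambda_rs W Q F \<and> X = A' + B' + C' + D' \<and>
      mscale \<i> A - mscale \<i> (C + D) = mscale \<i> A' - mscale \<i> (C' + D')"
    using A B C D X by blast
  fix Z
  assume "\<exists>A B C D. A \<in> eta_plus W Q F \<and> B \<in> eta_zero W Q F \<and> C \<in> eta_minus W Q F \<and>
      D \<in> Lambda_rs W Q F \<and> X = A + B + C + D \<and> Z = mscale \<i> A - mscale \<i> (C + D)"
  then obtain A' B' C' D' where A': "A' \<in> eta_plus W Q F" and B': "B' \<in> eta_zero W Q F"
    and C': "C' \<in> eta_minus W Q F" and D': "D' \<in> Lambda_rs W Q F" and X': "X = A' + B' + C' + D'"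
    and Z: "Z = mscale \<i> A' - mscale \<i> (C' + D')" by blast
  let ?I = "deligne F W"
  have sA: "shifts ?I (\<lambda>r s. r \<ge> 0 \<and> s < 0) (A - A')"
    using A A' unfolding eta_plus_def by (intro shifts_diff[OF big] gsum_shifts[OF big])
  have sB: "shifts ?I (\<lambda>r s. r = 0 \<and> s = 0) (B - B')"
    using B B' unfolding eta_zero_def by (intro shifts_diff[OF big] gsum_shifts[OF big])
  have "shifts ?I (\<lambda>r s. r < 0) C" "shifts ?I (\<lambda>r s. r < 0) C'"
    using C C' unfolding eta_minus_def by (auto dest!: gsum_shifts[OF big] elim!: shifts_mono)
  moreover have "shifts ?I (\<lambda>r s. r < 0) D" "shifts ?I (\<lambda>r s. r < 0) D'"
    using D D' unfolding Lambda_rs_def by (auto dest!: gsum_shifts[OF big] elim!: shifts_mono)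
  ultimately have sC: "shifts ?I (\<lambda>r s. r < 0) ((C' + D') - (C + D))"
    by (intro shifts_diff[OF big] shifts_add[OF big])
  have eq: "(A - A') + (B - B') = (C' + D') - (C + D)" using X X' by (simp add: algebra_simps)
  have "shifts ?I (\<lambda>r s. r \<ge> 0) ((A - A') + (B - B'))"
    by (intro shifts_add[OF big] shifts_mono[OF sA] shifts_mono[OF sB]) auto
  then have CD: "(C' + D') - (C + D) = 0"
    unfolding eq by (rule shifts_disjoint[OF big _ sC]) auto
  then have "A' - A = B - B'" using eq by (simp add: algebra_simps)
  moreover have "shifts ?I (\<lambda>r s. r \<ge> 0 \<and> s < 0) (A' - A)"
    using A A' unfolding eta_plus_def by (intro shifts_diff[OF big] gsum_shifts[OF big])
  ultimately have "A' - A = 0" using shifts_disjoint[OF big _ sB] by auto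
  with CD show "Z = mscale \<i> A - mscale \<i> (C + D)" unfolding Z by simp
qed

end

section \<open>Transport of the Deligne bigrading by a map that is real on the graded
  quotients\<close>

lemma graded_real_map_deligne:
  assumes "mixed_hodge W F" and "mixed_hodge W G" and inv: "invertible h"
    and hW: "\<And>k. mimg h (W k) \<subseteq> W k"
    and hreal: "\<And>k. mimg (h - cmconj h) (W k) \<subseteq> W (k - 1)"
    and Gr: "\<And>k p. mimg h (sumset (F p \<inter> W k) (W (k - 1))) = sumset (G p \<inter> W k) (W (k - 1))"
    and Y: "h ** Yop F W ** matrix_inv h = Yop G W"
    and v: "v \<in> deligne F W p q"
  shows "h *v v \<in> deligne G W p q"
proof -
  interpret F: mixed_hodge W F by fact
  interpret G: mixed_hodge W G by fact
  let ?I = "deligne F W" and ?J = "deligne G W" and ?w = "h *v v"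
  note bigJ = G.bigrading_deligne
  have WJ: "bproj ?J r s u = 0" if "u \<in> W k" "r + s > k" for u r s k
    using that by (simp add: G.W_eq_isum_deligne mem_isum_iff[OF bigJ])
  have mult: "h *v x \<in> sumset (G p \<inter> W k) (W (k - 1))" if "x \<in> sumset (F p \<inter> W k) (W (k - 1))" for x p k
    using that Gr[of p k] by (auto simp: mimg_def)
  \<comment> \<open>Intertwining the weight operators makes the image an eigenvector with eigenvalue
    \<open>p + q\<close>, so no other weight occurs.\<close>
  have weight: "bproj ?J r s ?w = 0" if "r + s \<noteq> p + q" for r s
  proof -
    have "Yop G W *v ?w = h *v (Yop F W *v v)"
      unfolding Y[symmetric] using matrix_inv_mul(2)[OF inv]
      by (simp flip: matrix_mul_assoc add: matrix_vector_mul_assoc)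
    also have "\<dots> = of_int (p + q) *s ?w" by (simp only: F.Yop_deligne[OF v] vec.scale)
    finally have "of_int (r + s) *s bproj ?J r s ?w = of_int (p + q) *s bproj ?J r s ?w"
      using G.bproj_Yop[of r s ?w] by (simp only: bproj_scale[OF bigJ])
    then have "(of_int (r + s) - of_int (p + q) :: complex) *s bproj ?J r s ?w = 0"
      by (simp only: vec.scale_left_diff_distrib) simp
    moreover have "(of_int (r + s) - of_int (p + q) :: complex) \<noteq> 0"
      using that by (simp only: of_int_diff[symmetric] of_int_eq_0_iff)
    ultimately show ?thesis by (simp only: vec.scale_eq_0_iff) simp
  qed
  have hodge: "bproj ?J r s ?w = 0" if "r < p" "r + s = p + q" for r s
  proof -
    have "v \<in> sumset (F p \<inter> W (p + q)) (W (p + q - 1))"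
      unfolding sumset_def using F.deligne_F[OF v] F.deligne_W[OF v] F.W_zero by force
    then obtain f u where f: "f \<in> G p" "u \<in> W (p + q - 1)" "?w = f + u"
      using mult unfolding sumset_def by blast
    have "bproj ?J r s f = 0"
      using f(1) that(1) by (simp add: G.F_eq_isum_deligne mem_isum_iff[OF bigJ])
    then show ?thesis using f WJ[OF f(2)] that by (simp add: bproj_add[OF bigJ])
  qed
  \<comment> \<open>The conjugate of \<open>v\<close> has type \<open>(q, p)\<close> modulo lower
    weight, so \<open>h\<close> sends it into \<open>G q\<close> modulo lower weight. As
    \<open>h\<close> and its conjugate agree on the graded quotient, conjugating back bounds the
    second index.\<close>
  have conj_hodge: "bproj ?J r s ?w = 0" if "s < q" "r + s = p + q" for r s
  proof -
    obtain y where y: "y \<in> ?I q p" "cvconj v - y \<in> isum ?I (\<lambda>r s. r < q \<and> s < p)"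
      using F.conj_deligne[OF v] .
    have "cvconj v - y \<in> W (p + q - 1)"
      using y(2) by (auto simp: F.W_eq_isum_deligne mem_isum_iff[OF F.bigrading_deligne])
    moreover have "y \<in> F q \<inter> W (p + q)"
      using F.deligne_F[OF y(1)] F.deligne_W[OF y(1)] by (simp add: add.commute)
    moreover have "cvconj v = y + (cvconj v - y)" by simp
    ultimately have "cvconj v \<in> sumset (F q \<inter> W (p + q)) (W (p + q - 1))"
      unfolding sumset_def by blast
    then obtain f u where f: "f \<in> G q" "f \<in> W (p + q)" "u \<in> W (p + q - 1)" "h *v cvconj v = f + u"
      using mult unfolding sumset_def by blast
    have "cmconj h *v v = cvconj (h *v cvconj v)" by (simp add: cmconj_vector)
    then have w: "?w = cvconj f + (cvconj u + (h - cmconj h) *v v)"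
      using f(4) by (simp add: matrix_vector_mult_diff_rdistrib cvconj_add algebra_simps)
    have "(h - cmconj h) *v v \<in> W (p + q - 1)"
      using hreal[of "p + q"] F.deligne_W[OF v] by (auto simp: mimg_def)
    then have "cvconj u + (h - cmconj h) *v v \<in> W (p + q - 1)"
      using f(3) by (intro G.W_add) (simp_all add: G.W_conj_iff)
    then have 1: "bproj ?J r s (cvconj u + (h - cmconj h) *v v) = 0" using WJ that by simp
    have "f \<in> isum ?J (\<lambda>a b. a \<ge> q \<and> a + b \<le> p + q)"
      using f(1,2) by (auto simp: G.F_eq_isum_deligne G.W_eq_isum_deligne mem_isum_iff[OF bigJ])
    moreover have "isum ?J (\<lambda>a b. a \<ge> q \<and> a + b \<le> p + q) \<subseteq> {u. bproj ?J r s (cvconj u) = 0}"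
    proof (rule isum_least)
      show "csubspace {u. bproj ?J r s (cvconj u) = 0}"
        by (auto simp: csubspace_def cvconj_add cvconj_scale bproj_add[OF bigJ] bproj_scale[OF bigJ] bproj_zero[OF bigJ])
      fix a b x assume ab: "q \<le> a \<and> a + b \<le> p + q" and x: "x \<in> ?J a b"
      obtain y where y: "y \<in> ?J b a" "cvconj x - y \<in> isum ?J (\<lambda>r s. r < b \<and> s < a)"
        using G.conj_deligne[OF x] .
      have "bproj ?J r s y = 0" using ab that by (auto simp: bproj_of_mem[OF bigJ y(1)])
      moreover have "bproj ?J r s (cvconj x - y) = 0"
        using y(2) ab that by (auto simp: mem_isum_iff[OF bigJ])
      ultimately show "x \<in> {u. bproj ?J r s (cvconj u) = 0}" by (simp add: bproj_diff[OF bigJ])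
    qed
    ultimately have "bproj ?J r s (cvconj f) = 0" by blast
    with 1 show ?thesis unfolding w by (simp add: bproj_add[OF bigJ])
  qed
  \<comment> \<open>Fixed weight together with \<open>r \<ge> p\<close> and \<open>s \<ge> q\<close>
    leaves the single index \<open>(p, q)\<close>.\<close>
  have "bproj ?J r s ?w = 0" if "(r, s) \<noteq> (p, q)" for r s
    using that weight[of r s] hodge[of r s] conj_hodge[of s r] by (cases "r + s = p + q"; cases "r < p") auto
  then show ?thesis by (simp add: mem_iff_bproj[OF bigJ])
qed

text \<open>Since \<open>h\<close> intertwines the projections and is injective, the same components
  vanish before and after applying it.\<close>

lemma mem_isum_image_iff:
  fixes h :: "('n::finite) matC"
  assumes I: "bigrading I" and J: "bigrading J" and inv: "invertible h"
    and h: "\<And>p q v. v \<in> I p q \<Longrightarrow> h *v v \<in> J p q"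
  shows "h *v v \<in> isum J R \<longleftrightarrow> v \<in> isum I R"
proof -
  have "bproj J p q (h *v v) = h *v bproj I p q v" for p q v
  proof -
    have "v \<in> {v. bproj J p q (h *v v) = h *v bproj I p q v}"
      by (rule bigrading_all[OF I])
        (auto simp: csubspace_def bproj_add[OF I] bproj_add[OF J] bproj_scale[OF I] bproj_scale[OF J]
          bproj_zero[OF I] bproj_zero[OF J] vec.add vec.scale bproj_of_mem[OF I] bproj_of_mem[OF J h])
    then show ?thesis by simp
  qed
  moreover have "h *v u = 0 \<longleftrightarrow> u = 0" for u
    using matrix_inv_mul(2)[OF inv] by (metis matrix_vector_mul_assoc matrix_vector_mul_lid vec.zero)
  ultimately show ?thesis by (simp add: mem_isum_iff[OF I] mem_isum_iff[OF J])
qed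

section \<open>The differential equation\<close>

theorem theorem6p11:
  fixes W :: "int \<Rightarrow> (complex^('n::finite)) set" and Q :: "int \<Rightarrow> complex^'n^'n"
    and dF :: "int \<Rightarrow> nat" and N :: "complex^'n^'n"
    and Finf Fo :: "int \<Rightarrow> (complex^'n) set"
    and h h' :: "real \<Rightarrow> complex^'n^'n" and a :: real
  assumes standing: "standing W Q"
    and adm: "admissible_nilpotent_orbit W Q dF N Finf a"
    and Fo: "Fo \<in> Mset W Q dF" and split: "split_R Fo W"
    and hH: "\<forall>y>a. h y \<in> Hgrp W Q"
    and hdiff: "\<forall>y>a. (h has_vector_derivative h' y) (at y)"
    and ha1: "\<forall>y>a. \<forall>k p. mimg (h y) (sumset (Fo p \<inter> W k) (W (k - 1))) =
                           sumset (theta N Finf (\<i> * of_real y) p \<inter> W k) (W (k - 1))"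
    and ha2: "\<forall>y>a. h y ** Yop Fo W ** matrix_inv (h y) = Yop (theta N Finf (\<i> * of_real y)) W"
    and hb: "\<forall>y>a. matrix_inv (h y) ** h' y \<in> hlie W Q \<inter>
               {A + D + C | A D C. A \<in> eta_plus W Q Fo \<and> D \<in> Lambda_rs W Q Fo \<and> C \<in> eta_minus W Q Fo}"
  shows "\<forall>y>a. matrix_inv (h y) ** h' y = - Lop W Q Fo (matrix_inv (h y) ** N ** h y)"
proof (intro allI impI)
  fix y assume y: "y > a"

  \<comment> \<open>Transport of the bigrading along the curve\<close>
  define G where "G t = theta N Finf (\<i> * of_real t)" for t :: real
  define I where "I = deligne Fo W"
  define J where "J t = deligne (G t) W" for t
  interpret Fo: mixed_hodge W Fo by (rule Mset_imp_mixed_hodge[OF standing Fo])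
  have mhG: "mixed_hodge W (G t)" if "t > a" for t
    using that adm by (intro Mset_imp_mixed_hodge[OF standing, of _ dF])
      (auto simp: G_def admissible_nilpotent_orbit_def)
  have bigI: "bigrading I" unfolding I_def by (rule Fo.bigrading_deligne)
  have bigJ: "bigrading (J t)" if "t > a" for t
    unfolding J_def by (rule mixed_hodge.bigrading_deligne[OF mhG[OF that]])
  have I_conj: "cvconj ` I p q = I q p" for p q using split by (simp add: I_def split_R_def)
  have FI: "Fo p = isum I (\<lambda>a b. a \<ge> p)" for p
    unfolding I_def by (rule Fo.F_eq_isum_deligne)
  have WI: "W k = isum I (\<lambda>a b. a + b \<le> k)" for k
    unfolding I_def by (rule Fo.W_eq_isum_deligne)
  have hgrp: "invertible (h t)" "mimg (h t) (W k) \<subseteq> W k" "mimg (h t - cmconj (h t)) (W k) \<subseteq> W (k - 1)"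
    "u \<in> W k \<Longrightarrow> v \<in> W k \<Longrightarrow> bil (Q k) (h t *v u) (h t *v v) = bil (Q k) u v"
    if "t > a" for t k u v
    using hH that by (auto simp: Hgrp_def Ggrp_def GC_def)
  have hJ: "h t *v v \<in> J t p q" if "v \<in> I p q" "t > a" for t p q v
    unfolding J_def using that hgrp[OF that(2)] ha1 ha2
    by (intro graded_real_map_deligne[OF Fo.mixed_hodge_axioms mhG]) (auto simp: I_def G_def)
  have hisum: "h t *v v \<in> isum (J t) R \<longleftrightarrow> v \<in> isum I R" if "t > a" for t R v
    using that by (intro mem_isum_image_iff[OF bigI bigJ hgrp(1)] hJ)
  have hG: "h t *v v \<in> G t p \<longleftrightarrow> v \<in> Fo p" if "t > a" for t v p
    using hisum[OF that] mixed_hodge.F_eq_isum_deligne[OF mhG[OF that]] FI by (simp add: J_def)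
  have hW: "h t *v v \<in> W k \<longleftrightarrow> v \<in> W k" if "t > a" for t v k
    using hisum[OF that, of v "\<lambda>a b. a + b \<le> k"] mixed_hodge.W_eq_isum_deligne[OF mhG[OF that], of k] WI[of k]
    by (simp add: J_def)

  \<comment> \<open>The logarithmic derivative and the failure of \<open>h\<close> to be
    real\<close>
  define hi where "hi t = matrix_inv (h t)" for t
  have hi: "hi t ** h t = mat 1" "h t ** hi t = mat 1" if "t > a" for t
    unfolding hi_def using matrix_inv_mul[OF hgrp(1)[OF that]] by auto
  have chi: "cmconj (h y) ** cmconj (hi y) = mat 1"
    using hi(2)[OF y] by (metis cmconj_mul cmconj_mat_1)
  define A where "A = hi y ** h' y"
  define M where "M = hi y ** N ** h y"
  define B where "B = A - mscale \<i> M"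
  define k where "k t = hi t ** cmconj (h t)" for t
  have hA: "h y ** A = h' y" by (simp add: A_def matrix_mul_assoc hi(2)[OF y])
  have hM: "h y ** M = N ** h y" by (simp add: M_def matrix_mul_assoc hi(2)[OF y])
  obtain Ap D C where Ap: "Ap \<in> eta_plus W Q Fo" and D: "D \<in> Lambda_rs W Q Fo"
    and C: "C \<in> eta_minus W Q Fo" and A_eq: "A = Ap + D + C"
    using hb y unfolding A_def hi_def by blast
  have AgC: "A \<in> gC W Q" using hb y unfolding A_def hi_def by (auto simp: hlie_def)
  have N: "N \<in> gC W Q" "cmconj N = N" "nilpotent_mat N"
    using adm by (auto simp: admissible_nilpotent_orbit_def gR_def real_mat_def)
  have Finf: "csubspace (Finf p)" for p
    using adm by (auto simp: admissible_nilpotent_orbit_def Mcheck_def Mset_def intro!: csubspace_mimg)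

  \<comment> \<open>Invariance of the Lie algebra under the adjoint action\<close>
  have MgC: "M \<in> gC W Q"
  proof -
    have hMv: "h y *v (M *v v) = N *v (h y *v v)" for v
      using hM by (metis matrix_vector_mul_assoc)
    have MW: "M *v v \<in> W k" if "v \<in> W k" for v k
    proof -
      have "N *v (h y *v v) \<in> W k" using gC_W[OF N(1)] hW[OF y] that by simp
      then show ?thesis using hW[OF y] hMv by metis
    qed
    have "bil (Q k) (M *v u) v + bil (Q k) u (M *v v) = 0" if uv: "u \<in> W k" "v \<in> W k" for k u v
    proof -
      have "bil (Q k) (M *v u) v + bil (Q k) u (M *v v) =
          bil (Q k) (h y *v (M *v u)) (h y *v v) + bil (Q k) (h y *v u) (h y *v (M *v v))"
        using hgrp(4)[OF y] uv MW by simp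
      also have "\<dots> = 0" unfolding hMv using N(1) uv hW[OF y] by (simp add: gC_def)
      finally show ?thesis .
    qed
    with MW show ?thesis by (auto simp: gC_def mimg_def)
  qed

  \<comment> \<open>The constraint from the constant limit filtration\<close>
  have Bshift: "shifts I (\<lambda>r s. r \<ge> 0 \<and> r + s \<le> 0) B"
    unfolding shifts_def
  proof (intro allI ballI)
    fix p q v assume v: "v \<in> I p q"
    have vF: "v \<in> Fo p" and vW: "v \<in> W (p + q)"
      using v Fo.deligne_F Fo.deligne_W by (auto simp: I_def)
    \<comment> \<open>Composing with \<open>h y\<close> turns \<open>B\<close> into the expression
      controlled by \<open>nilpotent_orbit_frame_derivative\<close>; it lands in
      \<open>G y p\<close>, and \<open>hG\<close> pulls this back to \<open>Fo p\<close>.\<close>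
    have "h y *v (B *v v) = (h' y - mscale \<i> (N ** h y)) *v v"
      unfolding B_def by (simp add: matrix_vector_mult_diff_rdistrib mscale_vector vec.diff vec.scale
          matrix_vector_mul_assoc hA hM)
    also have "\<dots> \<in> mimg (mexp_nil (\<i> * of_real y) N) (Finf p)"
      by (rule nilpotent_orbit_frame_derivative[OF N(3) Finf _ y])
        (use hdiff y hG vF in \<open>auto simp: G_def theta_def\<close>)
    finally have "B *v v \<in> Fo p" using hG[OF y] by (simp add: G_def theta_def)
    moreover have "B *v v \<in> W (p + q)"
      using gC_W[OF AgC vW] gC_W[OF MgC vW] unfolding B_def
      by (simp add: matrix_vector_mult_diff_rdistrib mscale_vector Fo.W_diff Fo.W_scale)
    ultimately show "B *v v \<in> isum I (\<lambda>a b. a - p \<ge> 0 \<and> a - p + (b - q) \<le> 0)"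
      by (auto simp: FI WI mem_isum_iff[OF bigI])
  qed

  \<comment> \<open>Unipotence of \<open>k\<close>\<close>
  have kv: "k t *v v - v \<in> isum I (\<lambda>r s. r < p \<and> s < q)" if t: "t > a" and v: "v \<in> I p q" for t p q v
  proof -
    interpret Gt: mixed_hodge W "G t" by (rule mhG[OF t])
    have hk: "h t *v (k t *v v) = cmconj (h t) *v v"
      by (simp add: k_def matrix_vector_mul_assoc matrix_mul_assoc hi(2)[OF t])
    have "cvconj v \<in> I q p" using v I_conj[of p q] by blast
    then have "h t *v cvconj v \<in> deligne (G t) W q p" using hJ[OF _ t] by (simp add: J_def)
    then obtain x where x: "x \<in> J t p q"
      "cvconj (h t *v cvconj v) - x \<in> isum (J t) (\<lambda>r s. r < p \<and> s < q)"
      unfolding J_def using Gt.conj_deligne by blast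
    \<comment> \<open>The first summand has strictly smaller indices by the Deligne congruence. The
      second lies in \<open>J t p q\<close> and vanishes because \<open>h t\<close> is real on the
      graded quotients.\<close>
    have diff: "h t *v (k t *v v - v) = (cvconj (h t *v cvconj v) - x) + (x - h t *v v)"
      by (simp add: vec.diff hk cmconj_vector)
    have "(h t - cmconj (h t)) *v v \<in> W (p + q - 1)"
      using hgrp(3)[OF t, of "p + q"] v Fo.deligne_W[of v p q] by (auto simp: I_def mimg_def)
    then have "h t *v (k t *v v - v) \<in> W (p + q - 1)"
      using Fo.W_neg[of "(h t - cmconj (h t)) *v v" "p + q - 1"]
      by (simp add: vec.diff hk matrix_vector_mult_diff_rdistrib)
    then have "bproj (J t) p q (h t *v (k t *v v - v)) = 0"
      using Gt.W_eq_isum_deligne[of "p + q - 1"] by (simp add: J_def[symmetric] mem_isum_iff[OF bigJ[OF t]])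
    moreover have "bproj (J t) p q (cvconj (h t *v cvconj v) - x) = 0"
      using x(2) by (simp add: mem_isum_iff[OF bigJ[OF t]])
    ultimately have "bproj (J t) p q (x - h t *v v) = 0"
      unfolding diff by (simp add: bproj_diff[OF bigJ[OF t]])
    moreover have "x - h t *v v \<in> J t p q"
      using x(1) hJ[OF v t] csubspace_diff[OF bigrading_csubspace[OF bigJ[OF t]]] by blast
    ultimately have "x - h t *v v = 0" by (simp add: bproj_of_mem[OF bigJ[OF t]])
    then have "h t *v (k t *v v - v) \<in> isum (J t) (\<lambda>r s. r < p \<and> s < q)" using diff x(2) by simp
    then show ?thesis using hisum[OF t] by simp
  qed
  \<comment> \<open>The bidegrees occurring in the identity plus \<Lambda>; the condition is
    symmetric in the two indices.\<close>
  let ?U = "\<lambda>r s::int. (r = 0 \<and> s = 0) \<or> (r < 0 \<and> s < 0)"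
  have kshift: "shifts I ?U (k y)"
    unfolding shifts_def
  proof (intro allI ballI)
    fix p q v assume v: "v \<in> I p q"
    let ?K = "isum I (\<lambda>a b. ?U (a - p) (b - q))"
    have "isum I (\<lambda>r s. r < p \<and> s < q) \<subseteq> ?K" by (rule isum_mono) auto
    then have "k y *v v - v \<in> ?K" using kv[OF y v] by blast
    moreover have "v \<in> ?K" using v by (intro isum_incl[of _ p q]) auto
    ultimately show "k y *v v \<in> ?K" using csubspace_add[OF csubspace_isum[OF bigI], of "k y *v v - v" _ v] by simp
  qed
  have ckshift: "shifts I ?U (cmconj (k y))"
    by (rule shifts_mono[OF shifts_cmconj[OF bigI I_conj kshift]]) auto
  have k_inv: "k y ** cmconj (k y) = mat 1"
    using hi[OF y] chi by (simp add: k_def cmconj_mul matrix_mul_assoc) (simp flip: matrix_mul_assoc)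

  \<comment> \<open>Differentiating the relation between \<open>h\<close>, \<open>k\<close> and the
    conjugate of \<open>h\<close>\<close>
  obtain hi' where hi': "(hi has_vector_derivative hi') (at y)"
    using matrix_inv_has_vector_derivative[of h _ y a] hdiff y hgrp(1) unfolding hi_def[abs_def] by blast
  define k' where "k' = hi y ** cmconj (h' y) + hi' ** cmconj (h y)"
  have k': "(k has_vector_derivative k') (at y)"
    unfolding k_def[abs_def] k'_def
    using bounded_bilinear.has_vector_derivative[OF bounded_bilinear_matrix_mul hi'
        bounded_linear.has_vector_derivative[OF bounded_linear_cmconj]] hdiff y by blast
  have k'shift: "shifts I (\<lambda>r s. r < 0 \<and> s < 0) k'"
    unfolding shifts_def
  proof (intro allI ballI)
    fix p q v assume v: "v \<in> I p q"
    let ?K = "isum I (\<lambda>r s. r < p \<and> s < q)"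
    \<comment> \<open>Subtracting the constant \<open>v\<close> leaves the derivative unchanged and
      puts the curve into the fixed subspace \<open>?K\<close>, which has strictly smaller
      indices.\<close>
    have der: "((\<lambda>t. k t *v v - v) has_vector_derivative k' *v v - 0) (at y)"
      by (intro has_vector_derivative_diff has_vector_derivative_const
          bounded_linear.has_vector_derivative[OF bounded_linear_matrix_vector] k')
    have "k t *v v - v \<in> ?K" if "t > a" for t using kv[OF that v] .
    from vector_derivative_in_csubspace[OF csubspace_isum[OF bigI] this y der]
    show "k' *v v \<in> isum I (\<lambda>a b. a - p < 0 \<and> b - q < 0)" by simp
  qed
  have k'_eq: "k' = k y ** cmconj A - A ** k y"
  proof -
    have "((\<lambda>t. h t ** k t) has_vector_derivative h y ** k' + h' y ** k y) (at y)"
      using hdiff y by (intro bounded_bilinear.has_vector_derivative[OF bounded_bilinear_matrix_mul _ k']) auto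
    moreover have "((\<lambda>t. h t ** k t) has_vector_derivative cmconj (h' y)) (at y)"
    proof (rule has_vector_derivative_transform_within_open[of "\<lambda>t. cmconj (h t)" _ y "{a<..}"])
      show "((\<lambda>t. cmconj (h t)) has_vector_derivative cmconj (h' y)) (at y)"
        using hdiff y by (intro bounded_linear.has_vector_derivative[OF bounded_linear_cmconj]) auto
    qed (use y hi in \<open>auto simp: k_def matrix_mul_assoc\<close>)
    ultimately have "h y ** k' + h' y ** k y = cmconj (h' y)"
      by (rule vector_derivative_unique_at)
    then have "hi y ** (h y ** k' + h' y ** k y) = hi y ** cmconj (h y ** A)" by (simp add: hA)
    then have "k' + A ** k y = k y ** cmconj A"
      by (simp add: matrix_add_ldistrib matrix_mul_assoc hi(1)[OF y] cmconj_mul k_def A_def)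
    then show ?thesis by (simp add: algebra_simps)
  qed

  \<comment> \<open>Isolating the component of bidegree zero\<close>
  have M_eq: "k y ** cmconj M ** cmconj (k y) = M"
  proof -
    have "k y ** cmconj M ** cmconj (k y) =
      hi y ** (cmconj (h y) ** cmconj (hi y)) ** N ** (cmconj (h y) ** cmconj (hi y)) ** h y"
      by (simp add: k_def M_def cmconj_mul N(2) matrix_mul_assoc)
    then show ?thesis unfolding chi by (simp add: M_def)
  qed
  \<comment> \<open>The asserted formula requires \<open>M\<close> to have components
    \<open>i Ap\<close>, \<open>- i C\<close> and \<open>- i D\<close> outside bidegree
    \<open>(0, 0)\<close>. Removing these leaves \<open>M0\<close>, which therefore has to be shown
    homogeneous of bidegree \<open>(0, 0)\<close>.\<close>
  define M0 where "M0 = M - mscale \<i> Ap + mscale \<i> (C + D)"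
  have shAp: "shifts I (\<lambda>r s. r \<ge> 0 \<and> s < 0) Ap"
    using Ap gsum_shifts[OF Fo.W_csubspace Fo.bigrading_deligne] by (simp add: I_def eta_plus_def)
  have shC: "shifts I (\<lambda>r s. r < 0) C"
    unfolding I_def
    by (rule shifts_mono[OF gsum_shifts[OF Fo.W_csubspace Fo.bigrading_deligne C[unfolded eta_minus_def]]]) auto
  have shD: "shifts I (\<lambda>r s. r < 0) D"
    unfolding I_def
    by (rule shifts_mono[OF gsum_shifts[OF Fo.W_csubspace Fo.bigrading_deligne D[unfolded Lambda_rs_def]]]) auto
  \<comment> \<open>The first of two expressions for \<open>M0\<close>: it excludes negative first
    indices, since neither \<open>B\<close> nor \<open>Ap\<close> has any.\<close>
  have "mscale (- \<i>) M0 = B - mscale 2 Ap"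
    unfolding M0_def B_def A_eq by (simp add: mscale_def vec_eq_iff algebra_simps)
  then have M0a: "shifts I (\<lambda>r s. r \<ge> 0) (mscale (- \<i>) M0)"
    using shifts_diff[OF bigI shifts_mono[OF Bshift] shifts_mono[OF shifts_mscale[OF bigI shAp]], of "\<lambda>r s. r \<ge> 0"]
    by auto
  \<comment> \<open>By \<open>k'_eq\<close> the terms with the conjugate of \<open>A\<close> cancel,
    while conjugation reverses the sign in front of \<open>M\<close>. This leads to the second
    expression for \<open>M0\<close>.\<close>
  have "k y ** cmconj B ** cmconj (k y) - k' ** cmconj (k y) = A + mscale \<i> M"
  proof -
    have cB: "cmconj B = cmconj A + mscale \<i> (cmconj M)"
      by (simp add: B_def cmconj_diff cmconj_mscale) (simp add: mscale_def vec_eq_iff)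
    have "k y ** cmconj B ** cmconj (k y) = k y ** cmconj A ** cmconj (k y) + mscale \<i> M"
      unfolding cB by (simp add: matrix_add_ldistrib linear_add[OF linear_matrix_mul_right] mscale_mul_left mscale_mul_right M_eq)
    moreover have "k' ** cmconj (k y) = k y ** cmconj A ** cmconj (k y) - A"
      unfolding k'_eq by (simp add: linear_diff[OF linear_matrix_mul_right] k_inv flip: matrix_mul_assoc)
    ultimately show ?thesis by simp
  qed
  then have M0b_eq: "mscale \<i> M0 = k y ** cmconj B ** cmconj (k y) - k' ** cmconj (k y) - mscale 2 C - mscale 2 D"
    unfolding M0_def A_eq by (simp add: mscale_def vec_eq_iff algebra_simps)
  let ?R = "\<lambda>r s::int. (r = 0 \<and> s = 0) \<or> r < 0"
  \<comment> \<open>From \<open>s \<ge> 0\<close> and \<open>s + r \<le> 0\<close>, either both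
    indices vanish or \<open>r < 0\<close>. Multiplication by \<open>k y\<close> and its conjugate
    preserves this alternative, which excludes every bidegree with \<open>r \<ge> 0\<close> except
    \<open>(0, 0)\<close>.\<close>
  have cBsh: "shifts I (\<lambda>r s. s \<ge> 0 \<and> s + r \<le> 0) (cmconj B)"
    by (rule shifts_cmconj[OF bigI I_conj Bshift])
  have "shifts I ?R (k y ** cmconj B)" by (rule shifts_mul[OF bigI kshift cBsh]) auto
  then have "shifts I ?R (k y ** cmconj B ** cmconj (k y))" by (rule shifts_mul[OF bigI _ ckshift]) auto
  moreover have "shifts I ?R (k' ** cmconj (k y))" by (rule shifts_mul[OF bigI k'shift ckshift]) auto
  moreover have "shifts I ?R (mscale 2 C)" "shifts I ?R (mscale 2 D)"
    by (auto intro!: shifts_mono[OF shifts_mscale[OF bigI shC]] shifts_mono[OF shifts_mscale[OF bigI shD]])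
  ultimately have M0b: "shifts I ?R (mscale \<i> M0)"
    unfolding M0b_eq by (intro shifts_diff[OF bigI])
  have M0I: "M0 *v v \<in> I p q" if v: "v \<in> I p q" for p q v
  proof -
    have "shifts I (\<lambda>r s. r \<ge> 0) M0" "shifts I ?R M0"
      using shifts_mscale[OF bigI M0a, of \<i>] shifts_mscale[OF bigI M0b, of "- \<i>"]
      by (simp_all add: mscale_mscale mscale_one)
    from shiftsD[OF this(1) v] shiftsD[OF this(2) v]
    have "bproj I r s (M0 *v v) = 0" if "(r, s) \<noteq> (p, q)" for r s
      using that by (cases "r < p") (auto simp: mem_isum_iff[OF bigI])
    then show ?thesis by (simp add: mem_iff_bproj[OF bigI])
  qed

  \<comment> \<open>Evaluation of \<open>L\<close>\<close>
  have W: "csubspace (W k)" for k by (rule Fo.W_csubspace)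
  have csI: "csubspace (deligne Fo W p q)" for p q
    using bigrading_csubspace[OF bigI] by (simp add: I_def)
  have "M0 = M + mscale (- \<i>) Ap + mscale \<i> C + mscale \<i> D"
    unfolding M0_def by (simp add: mscale_def vec_eq_iff algebra_simps)
  moreover have "Ap \<in> gC W Q" "C \<in> gC W Q" "D \<in> gC W Q"
    using Ap C D gsum_gC[OF W] by (auto simp: eta_plus_def eta_minus_def Lambda_rs_def)
  ultimately have "M0 \<in> gC W Q" using MgC by (auto intro!: gC_add[OF W] gC_mscale[OF W])
  then have "M0 \<in> grs W Q Fo 0 0" using M0I by (auto simp: grs_def I_def mimg_def)
  then have M0: "M0 \<in> eta_zero W Q Fo"
    unfolding eta_zero_def gsum_def by (auto intro!: exI[of _ "{(0, 0)}"] exI[of _ "\<lambda>_. M0"])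
  have "Lop W Q Fo M = mscale \<i> (mscale \<i> Ap) - mscale \<i> (mscale (- \<i>) C + mscale (- \<i>) D)"
  proof (rule Lop_eqI[OF W Fo.bigrading_deligne _ M0])
    show "mscale \<i> Ap \<in> eta_plus W Q Fo"
      using Ap gsum_mscale[OF W csI] by (simp add: eta_plus_def)
    show "mscale (- \<i>) C \<in> eta_minus W Q Fo"
      using C gsum_mscale[OF W csI] by (simp add: eta_minus_def)
    show "mscale (- \<i>) D \<in> Lambda_rs W Q Fo"
      using D gsum_mscale[OF W csI] by (simp add: Lambda_rs_def)
    show "M = mscale \<i> Ap + M0 + mscale (- \<i>) C + mscale (- \<i>) D"
      unfolding M0_def by (simp add: mscale_def vec_eq_iff algebra_simps)
  qed
  also have "\<dots> = - A" unfolding A_eq by (simp add: mscale_def vec_eq_iff algebra_simps)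
  finally show "matrix_inv (h y) ** h' y = - Lop W Q Fo (matrix_inv (h y) ** N ** h y)"
    by (simp add: A_def M_def hi_def)
qed

end
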